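(* Let $\alpha=(\alpha_1,\dots,\alpha_d)$ be a probability distribution on $[d]$ with $\alpha_1\ge\alpha_2\ge\cdots\ge\alpha_d$, let $n\in\mathbb N$, and let $\lambda\sim\mathrm{SW}^n(\alpha)$. Then for every $k\in[d]$, \[ \alpha_k n-2\sqrt{\alpha_k k\, n}\;\le\;\mathbb E[\lambda_k]\;\le\;\alpha_k n+2\sqrt{(\alpha_k+\alpha_{k+1}+\cdots+\alpha_d)\,n}. \] In particular, writing $\nu_k=\min\{1,\alpha_k d\}$, one has $\alpha_k n-2\sqrt{\nu_k n}\le \mathbb E[\lambda_k]\le \alpha_k n+2\sqrt{\nu_k n}$.
   Context: For a word $w\in[d]^n$, a (weakly) increasing subsequence is $(w_{i_1},\dots,w_{i_\ell})$ with $i_1<\cdots<i_\ell$ and $w_{i_1}\le\cdots\le w_{i_\ell}$. The RSK shape $\lambda=\mathrm{shRSK}(w)$ is the Young diagram $\lambda_1\ge\lambda_2\ge\cdots\ge\lambda_d\ge0$, $\sum_i\lambda_i=n$, produced by the Robinson–Schensted–Knuth algorithm; equivalently (Greene's theorem) $\lambda_1+\cdots+\lambda_k$ equals the maximum total length of a union of $k$ disjoint weakly increasing subsequences of $w$. For a probability distribution $\alpha$ on $[d]$, the Schur–Weyl distribution $\mathrm{SW}^n(\alpha)$ is the law of $\mathrm{shRSK}(\boldsymbol w)$ where $\boldsymbol w\in[d]^n$ has i.i.d. letters drawn from $\alpha$. *)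

theory Defs
  imports Complex_Main
begin

text \<open>Robinson--Schensted--Knuth row insertion (for words, i.e. semistandard
  tableaux): inserting x into a weakly increasing row bumps the leftmost entry
  strictly greater than x, or appends x at the end if there is none.\<close>

fun row_insert :: "nat \<Rightarrow> nat list \<Rightarrow> nat option \<times> nat list" where
  "row_insert x [] = (None, [x])"
| "row_insert x (y # ys) =
     (if x < y then (Some y, x # ys)
      else (let (b, r) = row_insert x ys in (b, y # r)))"

fun tab_insert :: "nat \<Rightarrow> nat list list \<Rightarrow> nat list list" where
  "tab_insert x [] = [[x]]"
| "tab_insert x (r # rs) =
     (case row_insert x r of
        (None, r') \<Rightarrow> r' # rs
      | (Some y, r') \<Rightarrow> r' # tab_insert y rs)"

definition rsk_tableau :: "nat list \<Rightarrow> nat list list" where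
  "rsk_tableau w = fold tab_insert w []"

definition shRSK :: "nat list \<Rightarrow> nat list" where
  "shRSK w = map length (rsk_tableau w)"

definition shape_part :: "nat list \<Rightarrow> nat \<Rightarrow> nat" where
  "shape_part lam k = (if 1 \<le> k \<and> k \<le> length lam then lam ! (k - 1) else 0)"

definition words :: "nat \<Rightarrow> nat \<Rightarrow> nat list set" where
  "words d n = {w. length w = n \<and> set w \<subseteq> {1..d}}"

definition prob_dist :: "nat \<Rightarrow> (nat \<Rightarrow> real) \<Rightarrow> bool" where
  "prob_dist d \<alpha> \<longleftrightarrow> (\<forall>i\<in>{1..d}. 0 \<le> \<alpha> i) \<and> (\<Sum>i=1..d. \<alpha> i) = 1"

text \<open>E[lambda_k] for lambda ~ SW^n(alpha): expectation over a word with
  i.i.d. letters distributed according to alpha.\<close>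
definition SW_expect_part :: "nat \<Rightarrow> (nat \<Rightarrow> real) \<Rightarrow> nat \<Rightarrow> nat \<Rightarrow> real" where
  "SW_expect_part d \<alpha> n k =
     (\<Sum>w\<in>words d n. (\<Prod>i<n. \<alpha> (w ! i)) * real (shape_part (shRSK w) k))"

end

theory Submission
  imports Defs "HOL-Probability.Product_PMF"
begin

text \<open>
  Each row of the tableau is fed by the letters bumped out of the row above, and a word is Knuth
  equivalent to its bumped letters followed by its first row. Any action of the letters that
  respects the Knuth relations may therefore be pushed down row by row. Applied to row insertion
  that ignores the letters below k, this bounds the k-th row from above by the first row of the
  word restricted to \<open>{k..d}\<close>; applied to k - 1 queues in tandem, where letter k is an arrival and
  letter j < k serves queue j, it bounds the k-th row from below by the number of departures.

  Both the first row (seen through its letter counts) and the tandem queue have product-form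
  stationary distributions with geometric marginals: for the row add an extra letter of rate
  \<open>\<alpha> k + \<epsilon>\<close> smaller than all others, for the queues thin the arrivals to rate \<open>\<alpha> k - \<epsilon>\<close>.
  Monotonicity shows that these modifications only help, so in equilibrium the mean growth per
  letter is at most \<open>\<alpha> k + \<epsilon>\<close>, respectively at least \<open>\<alpha> k - \<epsilon>\<close>. Starting empty instead
  costs at most the mean number of particles, a sum of terms at most \<open>\<alpha> i / \<epsilon>\<close>, respectively
  \<open>\<alpha> k / \<epsilon>\<close>. Optimising over \<open>\<epsilon>\<close> gives the constants 2.
\<close>

section \<open>Geometric product distributions\<close>

lemma integrable_pmf_bounded:
  fixes F :: "'a \<Rightarrow> real"
  assumes "\<And>x. x \<in> set_pmf p \<Longrightarrow> 0 \<le> F x \<and> F x \<le> B"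
  shows "integrable (measure_pmf p) F"
  by (rule measure_pmf.integrable_const_bound[where B = B])
     (use assms in \<open>auto simp: AE_measure_pmf_iff\<close>)

text \<open>An \<open>nn_integral\<close> over \<open>bind_pmf\<close> splits unconditionally, so
  the computation runs in \<open>ennreal\<close> and is transferred back by the integrability
  assumptions.\<close>

lemma expectation_bernoulli_mixture:
  fixes F :: "'a \<Rightarrow> real"
  assumes q: "0 \<le> q" "q \<le> 1"
    and p: "p = bind_pmf (bernoulli_pmf q) (\<lambda>b. if b then p1 else p2)"
    and nn: "\<And>x. 0 \<le> F x"
    and int: "integrable (measure_pmf p) F" "integrable (measure_pmf p1) F" "integrable (measure_pmf p2) F"
  shows "measure_pmf.expectation p F
    = q * measure_pmf.expectation p1 F + (1 - q) * measure_pmf.expectation p2 F"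
proof -
  have nonneg: "0 \<le> measure_pmf.expectation p1 F" "0 \<le> measure_pmf.expectation p2 F"
    using nn by (auto intro: integral_nonneg_AE)
  have "ennreal (measure_pmf.expectation p F) = (\<integral>\<^sup>+x. ennreal (F x) \<partial>measure_pmf p)"
    using nn_integral_eq_integral[OF int(1)] nn by simp
  also have "\<dots> = ennreal q * (\<integral>\<^sup>+x. ennreal (F x) \<partial>measure_pmf p1)
      + ennreal (1 - q) * (\<integral>\<^sup>+x. ennreal (F x) \<partial>measure_pmf p2)"
    by (subst p) (use q in \<open>simp add: mult.commute\<close>)
  also have "\<dots> = ennreal q * ennreal (measure_pmf.expectation p1 F)
      + ennreal (1 - q) * ennreal (measure_pmf.expectation p2 F)"
    using nn_integral_eq_integral[OF int(2)] nn_integral_eq_integral[OF int(3)] nn by simp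
  also have "\<dots> = ennreal (q * measure_pmf.expectation p1 F + (1 - q) * measure_pmf.expectation p2 F)"
    using q nonneg by (simp add: ennreal_mult ennreal_plus)
  finally show ?thesis
    using q nonneg nn by (subst (asm) ennreal_inj) (auto intro: integral_nonneg_AE)
qed

text \<open>\<open>geometric_pmf p\<close> counts failures before the first success, so site
  \<open>i\<close> holds \<open>m\<close> particles with probability
  \<open>(1 - \<rho> i) * \<rho> i ^ m\<close>: the stationary law of a queue with load
  \<open>\<rho> i\<close>.\<close>

definition geometric_config :: "nat set \<Rightarrow> (nat \<Rightarrow> real) \<Rightarrow> (nat \<Rightarrow> nat) pmf" where
  "geometric_config S \<rho> = Pi_pmf S 0 (\<lambda>i. geometric_pmf (1 - \<rho> i))"

abbreviation (input) config_mean :: "nat set \<Rightarrow> (nat \<Rightarrow> real) \<Rightarrow> ((nat \<Rightarrow> nat) \<Rightarrow> real) \<Rightarrow> real" where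
  "config_mean S \<rho> F \<equiv> measure_pmf.expectation (geometric_config S \<rho>) F"

abbreviation (input) add_at :: "nat \<Rightarrow> (nat \<Rightarrow> nat) \<Rightarrow> nat \<Rightarrow> nat" where
  "add_at i c \<equiv> c(i := Suc (c i))"

lemma geometric_config_support:
  assumes "finite S" "c \<in> set_pmf (geometric_config S \<rho>)" "i \<notin> S"
  shows "c i = 0"
  using subsetD[OF set_Pi_pmf_subset[OF assms(1)] assms(2)[unfolded geometric_config_def]] assms(3)
  by simp

text \<open>Memorylessness: a geometric variable is 0 with probability \<open>1 - \<rho> i\<close>
  and otherwise 1 plus a copy of itself, independently of the other sites. The stationarity
  computations for the row and the queues rest on this.\<close>

lemma geometric_config_resample:
  assumes "finite S" "i \<in> S" "0 \<le> \<rho> i" "\<rho> i < 1"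
  shows "geometric_config S \<rho> = bind_pmf (bernoulli_pmf (1 - \<rho> i))
    (\<lambda>b. if b then map_pmf (\<lambda>c. c(i := 0)) (geometric_config S \<rho>)
         else map_pmf (add_at i) (geometric_config S \<rho>))"
proof -
  define R where "R = geometric_config (S - {i}) \<rho>"
  define G where "G = geometric_pmf (1 - \<rho> i)"
  have *: "geometric_config S \<rho> = map_pmf (\<lambda>(y, f). f(i := y)) (pair_pmf G R)"
    using Pi_pmf_insert[of "S - {i}" i 0 "\<lambda>i. geometric_pmf (1 - \<rho> i)"] assms
    by (simp add: geometric_config_def R_def G_def insert_absorb)
  have G: "G = bind_pmf (bernoulli_pmf (1 - \<rho> i)) (\<lambda>b. if b then return_pmf 0 else map_pmf Suc G)"
    unfolding G_def by (rule geometric_bind_pmf_unfold) (use assms in auto)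
  have "geometric_config S \<rho> = bind_pmf G (\<lambda>y. map_pmf (\<lambda>f. f(i := y)) R)"
    unfolding * by (simp add: pair_pmf_def map_bind_pmf map_pmf_def bind_assoc_pmf bind_return_pmf)
  also have "\<dots> = bind_pmf (bernoulli_pmf (1 - \<rho> i))
     (\<lambda>b. bind_pmf (if b then return_pmf 0 else map_pmf Suc G) (\<lambda>y. map_pmf (\<lambda>f. f(i := y)) R))"
    by (subst G) (simp add: bind_assoc_pmf)
  also have "\<dots> = bind_pmf (bernoulli_pmf (1 - \<rho> i))
    (\<lambda>b. if b then map_pmf (\<lambda>c. c(i := 0)) (geometric_config S \<rho>)
         else map_pmf (add_at i) (geometric_config S \<rho>))"
    unfolding * 
    by (intro bind_pmf_cong refl)
       (simp add: pair_pmf_def map_bind_pmf map_pmf_def bind_assoc_pmf bind_return_pmf)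
  finally show ?thesis .
qed

text \<open>The bound is asked only of configurations supported in \<open>S\<close>, because the
  observables also read an output counter outside \<open>S\<close>, in which they are
  unbounded.\<close>

definition bounded_on_configs :: "nat set \<Rightarrow> ((nat \<Rightarrow> nat) \<Rightarrow> real) \<Rightarrow> bool" where
  "bounded_on_configs S F \<longleftrightarrow>
     (\<forall>c. 0 \<le> F c) \<and> (\<exists>B. \<forall>c. (\<forall>i. i \<notin> S \<longrightarrow> c i = 0) \<longrightarrow> F c \<le> B)"

lemma bounded_on_configs_integrable:
  assumes "bounded_on_configs S F" "finite S"
  shows "integrable (measure_pmf (geometric_config S \<rho>)) F"
proof -
  obtain B where "\<And>c. (\<forall>i. i \<notin> S \<longrightarrow> c i = 0) \<Longrightarrow> F c \<le> B" "\<And>c. 0 \<le> F c"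
    using assms unfolding bounded_on_configs_def by blast
  then show ?thesis
    by (intro integrable_pmf_bounded[where B = B]) (auto dest: geometric_config_support[OF assms(2)])
qed

lemma bounded_on_configs_upd:
  assumes "bounded_on_configs S F" "i \<in> S"
  shows "bounded_on_configs S (\<lambda>c. F (c(i := g c)))"
proof -
  obtain B where "\<And>c. (\<forall>i. i \<notin> S \<longrightarrow> c i = 0) \<Longrightarrow> F c \<le> B" "\<And>c. 0 \<le> F c"
    using assms unfolding bounded_on_configs_def by blast
  then show ?thesis
    unfolding bounded_on_configs_def using assms(2) by (intro conjI exI[of _ B] allI impI) auto
qed

lemma config_mean_resample:
  assumes S: "finite S" "i \<in> S" and \<rho>: "0 \<le> \<rho> i" "\<rho> i < 1" and F: "bounded_on_configs S F"
  shows "config_mean S \<rho> F = (1 - \<rho> i) * config_mean S \<rho> (\<lambda>c. F (c(i := 0)))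
      + \<rho> i * config_mean S \<rho> (\<lambda>c. F (add_at i c))"
proof -
  have "config_mean S \<rho> F
    = (1 - \<rho> i) * measure_pmf.expectation (map_pmf (\<lambda>c. c(i := 0)) (geometric_config S \<rho>)) F
      + (1 - (1 - \<rho> i)) * measure_pmf.expectation (map_pmf (add_at i) (geometric_config S \<rho>)) F"
    using \<rho> bounded_on_configs_integrable[OF F S(1)]
      bounded_on_configs_integrable[OF bounded_on_configs_upd[OF F S(2)] S(1)] F
    by (intro expectation_bernoulli_mixture geometric_config_resample[of S i \<rho>] assms)
       (auto simp: bounded_on_configs_def)
  then show ?thesis by simp
qed

lemma geometric_config_mean_count:
  assumes "finite S" "i \<in> S" "0 \<le> \<rho> i" "\<rho> i < 1"
  shows "integrable (measure_pmf (geometric_config S \<rho>)) (\<lambda>c. real (c i))"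
    and "config_mean S \<rho> (\<lambda>c. real (c i)) = \<rho> i / (1 - \<rho> i)"
proof -
  have *: "map_pmf (\<lambda>c. c i) (geometric_config S \<rho>) = geometric_pmf (1 - \<rho> i)"
    unfolding geometric_config_def using assms Pi_pmf_component[of S i 0 "\<lambda>i. geometric_pmf (1 - \<rho> i)"] by simp
  have "integrable (measure_pmf (map_pmf (\<lambda>c. c i) (geometric_config S \<rho>))) real"
    unfolding * by (rule integrable_real_geometric_pmf) (use assms in auto)
  then show "integrable (measure_pmf (geometric_config S \<rho>)) (\<lambda>c. real (c i))"
    by simp
  have "measure_pmf.expectation (map_pmf (\<lambda>c. c i) (geometric_config S \<rho>)) real = \<rho> i / (1 - \<rho> i)"
    unfolding * by (subst expectation_geometric_pmf) (use assms in auto)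
  then show "config_mean S \<rho> (\<lambda>c. real (c i)) = \<rho> i / (1 - \<rho> i)"
    by simp
qed

lemma config_lipschitz:
  fixes F :: "(nat \<Rightarrow> nat) \<Rightarrow> real"
  assumes "finite S" "\<And>i. i \<notin> S \<Longrightarrow> c i = 0"
    and lip: "\<And>c i. i \<in> S \<Longrightarrow> \<bar>F (add_at i c) - F c\<bar> \<le> 1"
  shows "\<bar>F c - F (\<lambda>_. 0)\<bar> \<le> (\<Sum>i\<in>S. real (c i))"
  using assms(2)
proof (induction "\<Sum>i\<in>S. c i" arbitrary: c)
  case 0
  then have "c = (\<lambda>_. 0)" using assms(1) by (auto simp: fun_eq_iff)
  then show ?case by simp
next
  case (Suc n)
  then obtain i where i: "i \<in> S" "c i > 0"
    by (metis gr0I nat.simps(3) sum.neutral)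
  define c' where "c' = c(i := c i - 1)"
  have c: "c = add_at i c'" using i by (auto simp: c'_def)
  have s: "(\<Sum>j\<in>S. c j) = Suc (\<Sum>j\<in>S. c' j)"
    using i assms(1) by (simp add: c'_def sum.remove[of S i])
  then have "\<bar>F c' - F (\<lambda>_. 0)\<bar> \<le> (\<Sum>i\<in>S. real (c' i))"
    using Suc by (intro Suc.hyps) (auto simp: c'_def)
  moreover have "(\<Sum>i\<in>S. real (c i)) = (\<Sum>i\<in>S. real (c' i)) + 1"
    using arg_cong[OF s, of real] by simp
  ultimately show ?case using lip[OF i(1), of c'] c by fastforce
qed

text \<open>The price of starting empty instead of in equilibrium: each particle changes
  \<open>F\<close> by at most 1, and a geometric site has mean
  \<open>\<rho> i / (1 - \<rho> i)\<close>.\<close>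

lemma config_mean_near_empty:
  assumes S: "finite S" and \<rho>: "\<And>i. i \<in> S \<Longrightarrow> 0 \<le> \<rho> i \<and> \<rho> i < 1"
    and F: "bounded_on_configs S F"
    and lip: "\<And>c i. i \<in> S \<Longrightarrow> \<bar>F (add_at i c) - F c\<bar> \<le> 1"
  shows "\<bar>config_mean S \<rho> F - F (\<lambda>_. 0)\<bar> \<le> (\<Sum>i\<in>S. \<rho> i / (1 - \<rho> i))"
proof -
  have int: "integrable (measure_pmf (geometric_config S \<rho>)) (\<lambda>c. real (c i))" if "i \<in> S" for i
    using geometric_config_mean_count that S \<rho> by auto
  note intF = bounded_on_configs_integrable[OF F S, of \<rho>]
  have "\<bar>config_mean S \<rho> F - F (\<lambda>_. 0)\<bar> = \<bar>config_mean S \<rho> (\<lambda>c. F c - F (\<lambda>_. 0))\<bar>"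
    using intF by simp
  also have "\<dots> \<le> config_mean S \<rho> (\<lambda>c. \<bar>F c - F (\<lambda>_. 0)\<bar>)"
    by (rule integral_abs_bound)
  also have "\<dots> \<le> config_mean S \<rho> (\<lambda>c. \<Sum>i\<in>S. real (c i))"
    using int intF config_lipschitz[OF S _ lip] geometric_config_support[OF S]
    by (intro integral_mono_AE) (auto simp: AE_measure_pmf_iff)
  also have "\<dots> = (\<Sum>i\<in>S. \<rho> i / (1 - \<rho> i))"
    using int geometric_config_mean_count(2)[of S] S \<rho> by simp
  finally show ?thesis .
qed

section \<open>Row insertion and the Knuth relations\<close>

lemma row_insert_None:
  "row_insert x r = (None, r') \<Longrightarrow> r' = r @ [x] \<and> (\<forall>y\<in>set r. y \<le> x)"
  by (induction x r arbitrary: r' rule: row_insert.induct) (auto split: if_splits prod.splits)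

lemma row_insert_Some:
  "row_insert x r = (Some y, r') \<Longrightarrow>
     x < y \<and> y \<in> set r \<and> add_mset y (mset r') = add_mset x (mset r) \<and> length r' = length r"
  by (induction x r arbitrary: r' rule: row_insert.induct)
     (auto split: if_splits prod.splits simp: add_mset_commute)

lemma row_insert_Some_least:
  "row_insert x r = (Some y, r') \<Longrightarrow> sorted r \<Longrightarrow> z \<in> set r \<Longrightarrow> x < z \<Longrightarrow> y \<le> z"
  by (induction x r arbitrary: r' rule: row_insert.induct) (auto split: if_splits prod.splits)

lemma set_row_insert: "set (snd (row_insert x r)) \<subseteq> insert x (set r)"
  by (induction x r rule: row_insert.induct) (auto split: prod.splits)

lemma sorted_row_insert: "sorted r \<Longrightarrow> sorted (snd (row_insert x r))"
proof (induction x r rule: row_insert.induct)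
  case (2 x y ys)
  then show ?case using set_row_insert[of x ys]
    by (auto split: prod.splits)
qed auto

lemma length_row_insert: "length r \<le> length (snd (row_insert x r))"
  by (induction x r rule: row_insert.induct) (auto split: prod.splits)

fun row_step :: "nat \<Rightarrow> nat list \<times> nat list \<Rightarrow> nat list \<times> nat list" where
  "row_step x (b, r) =
     (case row_insert x r of (None, r') \<Rightarrow> (b, r') | (Some y, r') \<Rightarrow> (b @ [y], r'))"

definition bumped_word :: "nat list \<Rightarrow> nat list" where
  "bumped_word w = fst (fold row_step w ([], []))"

definition first_row :: "nat list \<Rightarrow> nat list" where
  "first_row w = snd (fold row_step w ([], []))"

lemma bumped_word_Nil [simp]: "bumped_word [] = []"
  and first_row_Nil [simp]: "first_row [] = []"
  by (simp_all add: bumped_word_def first_row_def)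

lemma bumped_word_snoc: "bumped_word (w @ [x]) =
    (case fst (row_insert x (first_row w)) of None \<Rightarrow> bumped_word w | Some y \<Rightarrow> bumped_word w @ [y])"
  and first_row_snoc: "first_row (w @ [x]) = snd (row_insert x (first_row w))"
  by (cases "fold row_step w ([], [])"; auto simp: bumped_word_def first_row_def
        split: prod.splits option.splits)+

lemma rsk_tableau_snoc: "rsk_tableau (w @ [x]) = tab_insert x (rsk_tableau w)"
  by (simp add: rsk_tableau_def)

text \<open>Bumped letters reach the lower rows in the order in which they leave the first, so those
  rows form the tableau of the bumped word. The empty word is excluded since its tableau has no
  rows.\<close>

lemma rsk_tableau_first_row:
  "w \<noteq> [] \<Longrightarrow> rsk_tableau w = first_row w # rsk_tableau (bumped_word w)"
proof (induction w rule: rev_induct)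
  case (snoc x w)
  show ?case
  proof (cases "w = []")
    case True
    then show ?thesis
      using bumped_word_snoc[of "[]" x] first_row_snoc[of "[]" x] by (simp add: rsk_tableau_def)
  next
    case False
    then show ?thesis
      using snoc.IH
      by (auto simp: rsk_tableau_snoc bumped_word_snoc first_row_snoc split: prod.splits option.splits)
  qed
qed simp

lemma shape_part_first_row: "shape_part (shRSK w) (Suc 0) = length (first_row w)"
proof (cases "w = []")
  case True
  then show ?thesis by (simp add: shape_part_def shRSK_def rsk_tableau_def)
next
  case False
  then show ?thesis by (simp add: shape_part_def shRSK_def rsk_tableau_first_row)
qed

lemma shape_part_bumped_word:
  "shape_part (shRSK w) (Suc (Suc k)) = shape_part (shRSK (bumped_word w)) (Suc k)"
proof (cases "w = []")
  case True
  then show ?thesis by (simp add: shape_part_def shRSK_def rsk_tableau_def)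
next
  case False
  then show ?thesis by (simp add: shape_part_def shRSK_def rsk_tableau_first_row)
qed

lemma sorted_first_row: "sorted (first_row w)"
  by (induction w rule: rev_induct) (simp_all add: first_row_snoc sorted_row_insert)

lemma first_row_ge: "\<forall>x\<in>set w. a \<le> x \<Longrightarrow> \<forall>x\<in>set (first_row w). a \<le> x"
  by (induction w rule: rev_induct) (use set_row_insert in \<open>fastforce simp: first_row_snoc\<close>)+

text \<open>A bumped letter strictly exceeds the one that bumps it. Hence each passage to a lower
  row raises the lower bound on the letters by one.\<close>

lemma bumped_word_ge: "\<forall>x\<in>set w. a \<le> x \<Longrightarrow> \<forall>x\<in>set (bumped_word w). Suc a \<le> x"
proof (induction w rule: rev_induct)
  case (snoc x w)
  then show ?case
    using row_insert_Some[of x "first_row w"]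
    by (cases "row_insert x (first_row w)") (fastforce simp: bumped_word_snoc split: option.splits)
qed simp

lemma first_row_eq_fold: "first_row w = fold (\<lambda>x r. snd (row_insert x r)) w []"
  by (induction w rule: rev_induct) (simp_all add: first_row_snoc)

section \<open>Actions of letters that respect the Knuth relations\<close>

text \<open>\<open>fold act\<close> reads a word from left to right, so the axioms say that the
  words \<open>y z x\<close> and \<open>y x z\<close> act alike for x < y \<le> z, and
  \<open>x z y\<close> and \<open>z x y\<close> for x \<le> y < z. The predicate \<open>inv\<close>
  restricts this to a class of states, such as sorted rows.\<close>

locale plactic_action =
  fixes act :: "nat \<Rightarrow> 's \<Rightarrow> 's" and inv :: "'s \<Rightarrow> bool"
  assumes inv_act: "inv s \<Longrightarrow> inv (act x s)"
    and knuth1: "inv s \<Longrightarrow> x < y \<Longrightarrow> y \<le> z \<Longrightarrow> act x (act z (act y s)) = act z (act x (act y s))"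
    and knuth2: "inv s \<Longrightarrow> x \<le> y \<Longrightarrow> y < z \<Longrightarrow> act y (act z (act x s)) = act y (act x (act z s))"
begin

lemma inv_fold: "inv s \<Longrightarrow> inv (fold act w s)"
  by (induction w arbitrary: s) (simp_all add: inv_act)

text \<open>The letter \<open>x\<close>, smaller than every entry, moves left past one entry at a
  time by \<open>knuth1\<close>; it stops behind \<open>a\<close>, since each exchange needs a
  larger letter in front.\<close>

lemma fold_move_small:
  "inv s \<Longrightarrow> sorted (a # r) \<Longrightarrow> x < a \<Longrightarrow> fold act (a # r @ [x]) s = fold act (a # x # r) s"
proof (induction r arbitrary: a s)
  case (Cons b r)
  have "fold act (a # (b # r) @ [x]) s = fold act (b # r @ [x]) (act a s)" by simp
  also have "\<dots> = fold act (b # x # r) (act a s)"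
    using Cons.prems by (intro Cons.IH inv_act) auto
  also have "\<dots> = fold act (a # x # b # r) s"
    using knuth1[of s x a b] Cons.prems by simp
  finally show ?case .
qed simp

text \<open>Row insertion as a rewriting of words. Past the bumped entry \<open>x\<close> is carried
  left by \<open>knuth1\<close>; through the entries before it \<open>y\<close> is carried left by
  \<open>knuth2\<close>.\<close>

lemma fold_row_insert:
  "inv s \<Longrightarrow> sorted r \<Longrightarrow> row_insert x r = (Some y, r') \<Longrightarrow>
     fold act (r @ [x]) s = fold act (y # r') s"
proof (induction r arbitrary: s r')
  case (Cons a r)
  show ?case
  proof (cases "x < a")
    case True
    then show ?thesis
      using fold_move_small[OF Cons.prems(1,2) True] Cons.prems(3) by auto
  next
    case False
    with Cons.prems(3) obtain t where t: "row_insert x r = (Some y, t)" "r' = a # t"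
      by (auto split: prod.splits)
    then obtain b q where r: "r = b # q" by (cases r) auto
    \<comment> \<open>The head \<open>h\<close> is \<open>x\<close> or an entry preceding the bumped
      one, hence a \<le> h < y, as \<open>knuth2\<close> requires to move \<open>y\<close> in front
      of \<open>a\<close>.\<close>
    obtain h u where h: "t = h # u" "a \<le> h" "h < y"
      using t Cons.prems(2) False row_insert_Some[OF t(1)] r by (auto split: if_splits prod.splits)
    have "fold act ((a # r) @ [x]) s = fold act (r @ [x]) (act a s)" by simp
    also have "\<dots> = fold act (y # t) (act a s)"
      using Cons.prems t by (intro Cons.IH inv_act) auto
    also have "\<dots> = fold act (y # r') s"
      using knuth2[OF Cons.prems(1) h(2,3)] h t by simp
    finally show ?thesis .
  qed
qed simp

text \<open>Each new letter is absorbed into the first row, and the letter it bumps leaves that row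
  on the left, which is the right end of the bumped word.\<close>

lemma fold_eq_bumped_first_row:
  "inv s \<Longrightarrow> fold act w s = fold act (bumped_word w @ first_row w) s"
proof (induction w rule: rev_induct)
  case (snoc x w)
  define s' where "s' = fold act (bumped_word w) s"
  have s': "inv s'" using snoc.prems by (simp add: s'_def inv_fold)
  have *: "fold act (w @ [x]) s = fold act (first_row w @ [x]) s'"
    using snoc by (simp add: s'_def)
  show ?case
  proof (cases "row_insert x (first_row w)")
    case (Pair b r')
    then show ?thesis
      using * row_insert_None[of x "first_row w" r']
        fold_row_insert[OF s' sorted_first_row, of x w _ r']
      by (cases b) (simp_all add: bumped_word_snoc first_row_snoc s'_def)
  qed
qed simp

end

section \<open>Comparison of single rows with plactic actions\<close>

definition insert_ge :: "nat \<Rightarrow> nat \<Rightarrow> nat list \<Rightarrow> nat list" where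
  "insert_ge k x r = (if k \<le> x then snd (row_insert x r) else r)"

lemma row_insert_knuth1:
  assumes "x < y" "y \<le> z"
  shows "snd (row_insert x (snd (row_insert z (snd (row_insert y r)))))
       = snd (row_insert z (snd (row_insert x (snd (row_insert y r)))))"
  using assms by (induction r) (auto split: prod.splits)

lemma row_insert_below:
  "\<forall>a\<in>set r. y < a \<Longrightarrow> snd (row_insert y r) = y # tl r"
  by (cases r) auto

lemma row_insert_knuth2:
  assumes "x \<le> y" "y < z" "sorted r"
  shows "snd (row_insert y (snd (row_insert z (snd (row_insert x r)))))
       = snd (row_insert y (snd (row_insert x (snd (row_insert z r)))))"
  using assms
proof (induction r)
  case (Cons a r)
  show ?case
  proof (cases "z < a")
    case True
    \<comment> \<open>All entries exceed \<open>z\<close>, so either order ends with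
      \<open>x\<close> and \<open>y\<close> in the first two places.\<close>
    with Cons.prems have "\<forall>b\<in>set r. z < b" "\<forall>b\<in>set r. y < b" by auto
    then show ?thesis using Cons.prems True
      by (auto split: prod.splits simp: row_insert_below dest!: arg_cong[of "row_insert _ _" _ snd])
  qed (use Cons in \<open>auto split: prod.splits\<close>)
qed auto

text \<open>The two sides of a Knuth relation differ only in the place of \<open>x\<close>, the
  smallest letter involved. If \<open>x\<close> is below \<open>k\<close>, it is ignored and the
  sides coincide; otherwise no letter is ignored.\<close>

lemma plactic_insert_ge: "plactic_action (insert_ge k) sorted"
  by unfold_locales
     (auto simp: insert_ge_def sorted_row_insert intro: row_insert_knuth1 row_insert_knuth2)

lemma length_fold_insert_ge: "length r \<le> length (fold (insert_ge k) w r)"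
  by (induction w arbitrary: r)
     (auto simp: insert_ge_def intro: order_trans[OF length_row_insert])

text \<open>Passing to the bumped word raises \<open>a\<close> and lowers \<open>k\<close> by one,
  so the threshold \<open>a + k\<close> stays fixed. Appending the first row afterwards cannot
  shorten the result, and by the Knuth relations it gives the same row as \<open>w\<close>.\<close>

lemma shape_part_le_restricted_row:
  "\<forall>x\<in>set w. a \<le> x \<Longrightarrow> shape_part (shRSK w) (Suc k) \<le> length (fold (insert_ge (a + k)) w [])"
proof (induction k arbitrary: a w)
  case 0
  have "fold (insert_ge a) w [] = fold (\<lambda>x r. snd (row_insert x r)) w []"
    using 0 by (intro fold_cong) (auto simp: insert_ge_def)
  then show ?case by (simp add: shape_part_first_row first_row_eq_fold)
next
  case (Suc k)
  interpret plactic_action "insert_ge (a + Suc k)" sorted by (rule plactic_insert_ge)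
  have "shape_part (shRSK w) (Suc (Suc k)) \<le> length (fold (insert_ge (a + Suc k)) (bumped_word w) [])"
    using Suc.IH[OF bumped_word_ge[OF Suc.prems]] by (simp add: shape_part_bumped_word)
  also have "\<dots> \<le> length (fold (insert_ge (a + Suc k)) (bumped_word w @ first_row w) [])"
    by (simp add: length_fold_insert_ge)
  also have "\<dots> = length (fold (insert_ge (a + Suc k)) w [])"
    using fold_eq_bumped_first_row[of "[]" w] by simp
  finally show ?case .
qed

section \<open>Queues in tandem as a plactic action\<close>

text \<open>Entry \<open>c 0\<close> counts the departures; letter \<open>k\<close> draws from an infinite supply, so
  the (truncated) value of \<open>c k\<close> is irrelevant.\<close>

definition busy :: "nat \<Rightarrow> nat \<Rightarrow> (nat \<Rightarrow> nat) \<Rightarrow> bool" where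
  "busy k j c \<longleftrightarrow> 1 \<le> j \<and> j \<le> k \<and> (j = k \<or> 0 < c j)"

definition serve :: "nat \<Rightarrow> nat \<Rightarrow> (nat \<Rightarrow> nat) \<Rightarrow> nat \<Rightarrow> nat" where
  "serve k j c = (if busy k j c then c(j := c j - 1, j - 1 := Suc (c (j - 1))) else c)"

lemma serve_other:
  assumes "i \<noteq> j" "j \<noteq> Suc i"
  shows "serve k j c i = c i"
  using assms by (cases j) (auto simp: serve_def busy_def)

lemma serve_commute_far:
  assumes "Suc x < z"
  shows "serve k x (serve k z c) = serve k z (serve k x c)"
proof -
  have "busy k x (serve k z c) = busy k x c" "busy k z (serve k x c) = busy k z c"
    using assms by (simp_all add: busy_def serve_other)
  moreover obtain u where "z = Suc u" using assms by (cases z) auto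
  moreover have "x \<noteq> 0" if "busy k x c" using that by (simp add: busy_def)
  ultimately show ?thesis
    using assms by (cases x; cases "busy k x c"; cases "busy k z c") (auto simp: serve_def fun_eq_iff)
qed

lemma serve_commute_adjacent:
  assumes "0 < c x"
  shows "serve k x (serve k (Suc x) c) = serve k (Suc x) (serve k x c)"
proof (cases "x = 0")
  case True
  then show ?thesis by (simp add: serve_def busy_def)
next
  case False
  then obtain y where x: "x = Suc y" by (cases x) auto
  have "busy k x (serve k (Suc x) c) = busy k x c" "busy k (Suc x) (serve k x c) = busy k (Suc x) c"
    using assms by (auto simp: x busy_def serve_def)
  then show ?thesis
    using assms by (cases "busy k x c"; cases "busy k (Suc x) c") (simp_all add: x serve_def fun_eq_iff)
qed

lemma serve_idle: "c x = 0 \<Longrightarrow> x \<noteq> k \<Longrightarrow> serve k x c = c"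
  by (simp add: serve_def busy_def)

lemma serve_next_empty: "serve k (Suc x) c x = 0 \<Longrightarrow> serve k (Suc x) c = c"
  by (auto simp: serve_def split: if_splits)

lemma serve_le: "serve k j c i \<le> Suc (c i)"
  by (auto simp: serve_def)

lemma serve_twice:
  assumes "c x \<le> 1" "x \<noteq> k"
  shows "serve k x (serve k x c) = serve k x c"
  using assms by (cases "x = 0") (auto simp: serve_def busy_def)

text \<open>Only neighbouring servers can fail to commute, which leaves y = z = x + 1. After a
  service at \<open>x + 1\<close>, queue \<open>x\<close> is either nonempty, so that the servers
  commute, or that service was idle and every service on both sides is idle too.\<close>

lemma serve_knuth1:
  assumes "x < y" "y \<le> z"
  shows "serve k x (serve k z (serve k y c)) = serve k z (serve k x (serve k y c))"
proof (cases "z = Suc x")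
  case True
  then have y: "y = Suc x" using assms by simp
  show ?thesis
  proof (cases "serve k (Suc x) c x = 0 \<and> x \<noteq> k")
    case idle: True
    then show ?thesis
      using serve_next_empty[of k x c] by (simp add: True y serve_idle)
  next
    case False
    then show ?thesis
      using serve_commute_adjacent[of "serve k (Suc x) c" x k]
      by (cases "x = k") (auto simp: True y serve_def[of k "Suc k"] busy_def[of k "Suc k"])
  qed
qed (use assms serve_commute_far[of x z k "serve k y c"] in simp)

text \<open>The critical case is y = x, z = x + 1. If queue \<open>x\<close> is empty, the service
  at \<open>x + 1\<close> supplies at most one customer, so the doubled service at \<open>x\<close>
  on the right counts once.\<close>

lemma serve_knuth2:
  assumes "x \<le> y" "y < z"
  shows "serve k y (serve k z (serve k x c)) = serve k y (serve k x (serve k z c))"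
proof (cases "z = Suc x")
  case True
  then have y: "y = x" using assms by simp
  show ?thesis
  proof (cases "c x = 0 \<and> x \<noteq> k")
    case idle: True
    have "serve k x (serve k x (serve k (Suc x) c)) = serve k x (serve k (Suc x) c)"
      using idle serve_le[of k "Suc x" c x] by (intro serve_twice) auto
    then show ?thesis
      using idle by (simp add: True y serve_idle)
  next
    case False
    then show ?thesis
      using serve_commute_adjacent[of c x k]
      by (cases "x = k") (auto simp: True y serve_def[of k "Suc k"] busy_def[of k "Suc k"])
  qed
qed (use assms serve_commute_far[of x z k c] in simp)

lemma plactic_serve: "plactic_action (serve k) (\<lambda>_. True)"
  by unfold_locales (auto intro: serve_knuth1 serve_knuth2)

lemma fold_serve_unchanged:
  "\<forall>j\<in>set w. Suc i < j \<Longrightarrow> fold (serve k) w c i = c i"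
  by (induction w arbitrary: c) (simp_all add: serve_other)

lemma fold_serve_le: "fold (serve k) w c i \<le> c i + length w"
proof (induction w arbitrary: c)
  case (Cons j w)
  show ?case using Cons.IH[of "serve k j c"] serve_le[of k j c i] by simp
qed simp

lemma serve_pair_le:
  assumes "j = Suc i" "Suc i < k"
  shows "serve k j c i + serve k j c (Suc i) \<le> c i + c (Suc i)"
  using assms by (auto simp: serve_def busy_def)

text \<open>In a sorted row the letters \<open>Suc i\<close> come first, so queue
  \<open>Suc i\<close> can release only what it held at the start: the services that refill it come
  too late.\<close>

lemma fold_serve_sorted_le:
  assumes "sorted r" "\<forall>j\<in>set r. Suc i \<le> j" "Suc i < k"
  shows "fold (serve k) r c i \<le> c i + c (Suc i)"
  using assms(1,2)
proof (induction r arbitrary: c)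
  case (Cons j r)
  show ?case
  proof (cases "j = Suc i")
    case True
    have "fold (serve k) (j # r) c i \<le> serve k j c i + serve k j c (Suc i)"
      using Cons by simp
    then show ?thesis using serve_pair_le[OF True assms(3), of c] by simp
  next
    case False
    with Cons.prems have "\<forall>l\<in>set (j # r). Suc i < l" by fastforce
    then show ?thesis using fold_serve_unchanged[of "j # r" i k c] by simp
  qed
qed simp

text \<open>With letters at least \<open>Suc i\<close>, entry \<open>i\<close> is the output of a
  tandem of \<open>m\<close> queues. The bumped word never touches entry \<open>i\<close> and by
  induction feeds at most the wanted row length into entry \<open>Suc i\<close>; the sorted first
  row can release no more than that. For m = 0 each letter of the first row releases at most one
  customer.\<close>

lemma tandem_output_le_shape_part:
  "\<forall>x\<in>set w. Suc i \<le> x \<Longrightarrow>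
     fold (serve (Suc (i + m))) w (\<lambda>_. 0) i \<le> shape_part (shRSK w) (Suc m)"
proof (induction m arbitrary: i w)
  case 0
  interpret plactic_action "serve (Suc i)" "\<lambda>_. True" by (rule plactic_serve)
  let ?c = "fold (serve (Suc i)) (bumped_word w) (\<lambda>_. 0)"
  have "fold (serve (Suc i)) w (\<lambda>_. 0) i = fold (serve (Suc i)) (first_row w) ?c i"
    by (subst fold_eq_bumped_first_row) simp_all
  also have "\<dots> \<le> ?c i + length (first_row w)" by (rule fold_serve_le)
  also have "?c i = 0"
    using bumped_word_ge[OF 0] by (subst fold_serve_unchanged) auto
  finally show ?case by (simp add: shape_part_first_row)
next
  case (Suc m)
  let ?k = "Suc (i + Suc m)"
  interpret plactic_action "serve ?k" "\<lambda>_. True" by (rule plactic_serve)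
  let ?c = "fold (serve ?k) (bumped_word w) (\<lambda>_. 0)"
  have "fold (serve ?k) w (\<lambda>_. 0) i = fold (serve ?k) (first_row w) ?c i"
    by (subst fold_eq_bumped_first_row) simp_all
  also have "\<dots> \<le> ?c i + ?c (Suc i)"
    using first_row_ge[OF Suc.prems] by (intro fold_serve_sorted_le sorted_first_row) auto
  also have "?c i = 0"
    using bumped_word_ge[OF Suc.prems] by (subst fold_serve_unchanged) auto
  also have "?c (Suc i) \<le> shape_part (shRSK (bumped_word w)) (Suc m)"
    using Suc.IH[OF bumped_word_ge[OF Suc.prems]] by simp
  finally show ?case by (simp add: shape_part_bumped_word)
qed

section \<open>Expectations over random words\<close>

definition word_mean :: "nat \<Rightarrow> (nat \<Rightarrow> real) \<Rightarrow> nat \<Rightarrow> (nat list \<Rightarrow> real) \<Rightarrow> real" where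
  "word_mean d \<alpha> n F = (\<Sum>w\<in>words d n. (\<Prod>i<n. \<alpha> (w ! i)) * F w)"

lemma word_mean_0 [simp]: "word_mean d \<alpha> 0 F = F []"
proof -
  have "words d 0 = {[]}" by (auto simp: words_def)
  then show ?thesis by (simp add: word_mean_def)
qed

text \<open>Conditioning on the first letter. Applied to a \<open>fold\<close>, it splits a run of
  \<open>Suc n\<close> letters into one step of the Markov chain and a run of \<open>n\<close>
  letters from the new state.\<close>

lemma word_mean_Suc:
  "word_mean d \<alpha> (Suc n) F = (\<Sum>i=1..d. \<alpha> i * word_mean d \<alpha> n (\<lambda>w. F (i # w)))"
proof -
  have *: "words d (Suc n) = (\<lambda>(i, w). i # w) ` ({1..d} \<times> words d n)"
    by (force simp: words_def length_Suc_conv)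
  have "word_mean d \<alpha> (Suc n) F
    = (\<Sum>(i, w)\<in>{1..d} \<times> words d n. (\<Prod>j<Suc n. \<alpha> ((i # w) ! j)) * F (i # w))"
    unfolding word_mean_def * by (subst sum.reindex) (auto simp: inj_on_def case_prod_unfold)
  also have "\<dots> = (\<Sum>(i, w)\<in>{1..d} \<times> words d n. \<alpha> i * ((\<Prod>j<n. \<alpha> (w ! j)) * F (i # w)))"
    by (simp add: prod.lessThan_Suc_shift mult.assoc del: prod.lessThan_Suc)
  also have "\<dots> = (\<Sum>i=1..d. \<alpha> i * word_mean d \<alpha> n (\<lambda>w. F (i # w)))"
    by (simp add: sum.cartesian_product[symmetric] word_mean_def sum_distrib_left)
  finally show ?thesis .
qed

lemma word_mean_add:
  "word_mean d \<alpha> n (\<lambda>w. F w + G w) = word_mean d \<alpha> n F + word_mean d \<alpha> n G"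
  by (simp add: word_mean_def sum.distrib distrib_left)

lemma word_mean_const:
  assumes "prob_dist d \<alpha>"
  shows "word_mean d \<alpha> n (\<lambda>_. b) = b"
proof (induction n)
  case (Suc n)
  then show ?case using assms by (simp add: word_mean_Suc prob_dist_def sum_distrib_right[symmetric])
qed simp

lemma word_mean_mono:
  assumes "prob_dist d \<alpha>" "\<And>w. length w = n \<Longrightarrow> set w \<subseteq> {1..d} \<Longrightarrow> F w \<le> G w"
  shows "word_mean d \<alpha> n F \<le> word_mean d \<alpha> n G"
proof -
  have "0 \<le> (\<Prod>i<n. \<alpha> (w ! i))" if "w \<in> words d n" for w
  proof (rule prod_nonneg)
    fix i assume "i \<in> {..<n}"
    then have "w ! i \<in> set w" using that by (auto simp: words_def)
    then have "w ! i \<in> {1..d}" using that by (auto simp: words_def)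
    then show "0 \<le> \<alpha> (w ! i)" using assms(1) by (auto simp: prob_dist_def)
  qed
  then show ?thesis
    unfolding word_mean_def using assms(2)
    by (intro sum_mono mult_left_mono) (auto simp: words_def)
qed

section \<open>The first row as a particle system\<close>

text \<open>A row is represented by its letter counts; the entry at \<open>Suc d\<close> records the row length,
  which grows exactly when no letter is bumped.\<close>

function expel :: "nat \<Rightarrow> nat \<Rightarrow> (nat \<Rightarrow> nat) \<Rightarrow> nat \<Rightarrow> nat" where
  "expel d i c =
     (if d < i then add_at (Suc d) c else if 0 < c i then c(i := c i - 1) else expel d (Suc i) c)"
  by pat_completeness auto
termination by (relation "Wellfounded.measure (\<lambda>(d, i, c). Suc d - i)") auto

declare expel.simps [simp del]

lemma expel_unfold:
  "d < i \<Longrightarrow> expel d i c = add_at (Suc d) c"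
  "i \<le> d \<Longrightarrow> 0 < c i \<Longrightarrow> expel d i c = c(i := c i - 1)"
  "i \<le> d \<Longrightarrow> c i = 0 \<Longrightarrow> expel d i c = expel d (Suc i) c"
  by (subst expel.simps, simp add: fun_eq_iff)+

lemma expel_hit:
  "i \<le> y \<Longrightarrow> y \<le> d \<Longrightarrow> 0 < c y \<Longrightarrow> (\<And>j. i \<le> j \<Longrightarrow> j < y \<Longrightarrow> c j = 0) \<Longrightarrow>
     expel d i c = c(y := c y - 1)"
proof (induction d i c rule: expel.induct)
  case (1 d i c)
  then show ?case
    by (cases "i = y") (auto simp: expel_unfold)
qed

lemma expel_miss:
  "(\<And>j. i \<le> j \<Longrightarrow> j \<le> d \<Longrightarrow> c j = 0) \<Longrightarrow> expel d i c = add_at (Suc d) c"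
proof (induction d i c rule: expel.induct)
  case (1 d i c)
  then show ?case by (cases "d < i") (simp_all add: expel_unfold)
qed

section \<open>Monotone coupling of rows\<close>

text \<open>Relates a configuration to a possible outcome of one expulsion from it. Every letter
  preserves the relation, so it couples two runs on the same word and keeps their outputs within 1
  of each other.\<close>

definition removed :: "nat \<Rightarrow> (nat \<Rightarrow> nat) \<Rightarrow> (nat \<Rightarrow> nat) \<Rightarrow> bool" where
  "removed d c c' \<longleftrightarrow> (\<exists>j\<le>d. 0 < c j \<and> c' = c(j := c j - 1)) \<or> c' = add_at (Suc d) c"

lemma removed_le: "removed d c c' \<Longrightarrow> i \<le> d \<Longrightarrow> c' i \<le> c i"
  by (auto simp: removed_def)

lemma removed_expel: "removed d c (expel d i c)"
proof (induction d i c rule: expel.induct)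
  case (1 d i c)
  show ?case
  proof (cases "\<not> d < i \<and> 0 < c i")
    case True
    then have "expel d i c = c(i := c i - 1)" "i \<le> d" by (simp_all add: expel_unfold)
    then show ?thesis using True unfolding removed_def by blast
  next
    case False
    then show ?thesis using 1 by (cases "d < i") (auto simp: expel_unfold removed_def)
  qed
qed

lemma removed_add_at:
  assumes "removed d c c'"
  shows "removed d (add_at i c) (add_at i c')"
  using assms unfolding removed_def
proof (elim disjE exE conjE)
  fix j assume "j \<le> d" "0 < c j" "c' = c(j := c j - 1)"
  then show "(\<exists>j\<le>d. 0 < add_at i c j \<and> add_at i c' = (add_at i c)(j := add_at i c j - 1)) \<or>
      add_at i c' = add_at (Suc d) (add_at i c)"
    by (intro disjI1 exI[of _ j]) (auto simp: fun_eq_iff)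
qed (auto simp: fun_eq_iff)

lemma removed_subtract_at:
  assumes "removed d c c'" "0 < c i" "0 < c' i" "i \<le> d"
  shows "removed d (c(i := c i - 1)) (c'(i := c' i - 1))"
  using assms(1) unfolding removed_def
proof (elim disjE exE conjE)
  fix j assume "j \<le> d" "0 < c j" "c' = c(j := c j - 1)"
  then show "(\<exists>j\<le>d. 0 < (c(i := c i - 1)) j \<and>
        c'(i := c' i - 1) = (c(i := c i - 1))(j := (c(i := c i - 1)) j - 1)) \<or>
      c'(i := c' i - 1) = add_at (Suc d) (c(i := c i - 1))"
    using assms(2,3) by (intro disjI1 exI[of _ j]) (auto simp: fun_eq_iff)
qed (use assms(4) in \<open>auto simp: fun_eq_iff\<close>)

lemma removed_expel_cong: "removed d c c' \<Longrightarrow> removed d (expel d i c) (expel d i c')"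
proof (induction d i c arbitrary: c' rule: expel.induct)
  case (1 d i c)
  consider "d < i" | "i \<le> d" "0 < c i" "0 < c' i" | "i \<le> d" "0 < c i" "c' i = 0"
    | "i \<le> d" "c i = 0" "c' i = 0"
    using removed_le[OF "1.prems", of i] by linarith
  then show ?case
  proof cases
    case 1
    then show ?thesis by (simp only: expel_unfold(1) removed_add_at[OF "1.prems"])
  next
    case 2
    then show ?thesis by (simp only: expel_unfold(2) removed_subtract_at[OF "1.prems"])
  next
    case 3
    \<comment> \<open>The particle that \<open>c\<close> has in excess sits at \<open>i\<close> and
      is the one expelled, which yields exactly \<open>c'\<close>; the attempt on \<open>c'\<close>
      moves on and makes the new difference.\<close>
    then have "expel d i c = c'" "expel d i c' = expel d (Suc i) c'"
      using "1.prems" by (auto simp: expel_unfold removed_def split: if_splits)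
    then show ?thesis by (simp add: removed_expel)
  next
    case 4
    then show ?thesis using "1.IH"[OF _ _ "1.prems"] by (simp add: expel_unfold)
  qed
qed

definition row_act :: "nat \<Rightarrow> nat \<Rightarrow> nat \<Rightarrow> (nat \<Rightarrow> nat) \<Rightarrow> nat \<Rightarrow> nat" where
  "row_act d k x c = (if k \<le> x then expel d (Suc x) (add_at x c) else c)"

lemma removed_fold_row_act:
  "removed d c c' \<Longrightarrow> set w \<subseteq> {1..d} \<Longrightarrow> removed d (fold (row_act d k) w c) (fold (row_act d k) w c')"
  by (induction w arbitrary: c c') (simp_all add: row_act_def removed_expel_cong removed_add_at)

lemma removed_output: "removed d c c' \<Longrightarrow> c (Suc d) \<le> c' (Suc d) \<and> c' (Suc d) \<le> Suc (c (Suc d))"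
  by (auto simp: removed_def)

lemma fold_row_act_output_le:
  "set w \<subseteq> {1..d} \<Longrightarrow> fold (row_act d k) w c (Suc d) \<le> length w + c (Suc d)"
proof (induction w arbitrary: c)
  case (Cons x w)
  have "row_act d k x c (Suc d) \<le> Suc (c (Suc d))"
    using removed_output[OF removed_expel[of d "add_at x c" "Suc x"]] Cons.prems
    by (auto simp: row_act_def)
  then show ?case using Cons.IH[of "row_act d k x c"] Cons.prems by simp
qed simp

section \<open>From rows to letter counts\<close>

definition encodes_row :: "nat \<Rightarrow> nat list \<Rightarrow> (nat \<Rightarrow> nat) \<Rightarrow> bool" where
  "encodes_row d r c \<longleftrightarrow> sorted r \<and> set r \<subseteq> {..d} \<and> (\<forall>i\<le>d. c i = count (mset r) i) \<and> c (Suc d) = length r"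

lemma encodes_row_empty: "encodes_row d [] (\<lambda>_. 0)"
  by (simp add: encodes_row_def)

text \<open>In a sorted row the leftmost entry exceeding \<open>x\<close> is the smallest letter
  above \<open>x\<close>, which \<open>expel\<close> finds by scanning upwards; if there is none,
  the row grows.\<close>

lemma encodes_row_insert_ge:
  assumes "encodes_row d r c" "x \<le> d"
  shows "encodes_row d (insert_ge k x r) (row_act d k x c)"
proof (cases "k \<le> x")
  case True
  obtain b r' where r': "row_insert x r = (b, r')" by fastforce
  have 1: "sorted r'" "set r' \<subseteq> {..d}"
    using assms sorted_row_insert[of r x] set_row_insert[of x r] r' by (auto simp: encodes_row_def)
  have c: "\<And>i. i \<le> d \<Longrightarrow> c i = count (mset r) i" "c (Suc d) = length r" "sorted r" "set r \<subseteq> {..d}"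
    using assms by (auto simp: encodes_row_def)
  show ?thesis
  proof (cases b)
    case None
    then have r'_eq: "r' = r @ [x]" "\<forall>y\<in>set r. y \<le> x" using row_insert_None r' by blast+
    have "expel d (Suc x) (add_at x c) = add_at (Suc d) (add_at x c)"
      using r'_eq c by (intro expel_miss) (auto simp: count_eq_zero_iff)
    then show ?thesis
      using True r' r'_eq 1 c assms(2) by (auto simp: encodes_row_def insert_ge_def row_act_def)
  next
    case (Some y)
    with r' have y: "row_insert x r = (Some y, r')" by simp
    have ins: "x < y" "y \<in> set r" "add_mset y (mset r') = add_mset x (mset r)" "length r' = length r"
      using row_insert_Some[OF y] by simp_all
    have ry: "y \<le> d" "0 < c y" using ins c by auto
    have "expel d (Suc x) (add_at x c) = (add_at x c)(y := add_at x c y - 1)"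
    proof (rule expel_hit)
      fix j assume j: "Suc x \<le> j" "j < y"
      then have "j \<notin> set r" using row_insert_Some_least[OF y c(3), of j] by auto
      then show "add_at x c j = 0" using j c(1)[of j] ry by (simp add: count_eq_zero_iff)
    qed (use ins ry in auto)
    moreover have "count (mset r') i = ((add_at x c)(y := add_at x c y - 1)) i" if "i \<le> d" for i
    proof -
      have "count (add_mset y (mset r')) i = count (add_mset x (mset r)) i" using ins by simp
      then have "(if i = y then 1 else 0) + count (mset r') i = (if i = x then 1 else 0) + count (mset r) i"
        by (auto split: if_splits)
      then show ?thesis using ins(1) ry c(1)[OF that] by (auto split: if_splits)
    qed
    ultimately show ?thesis
      using True r' 1 c assms(2) ins ry by (auto simp: encodes_row_def insert_ge_def row_act_def)
  qed
qed (use assms in \<open>simp add: insert_ge_def row_act_def\<close>)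

lemma length_fold_insert_ge_eq:
  assumes "set w \<subseteq> {1..d}"
  shows "length (fold (insert_ge k) w []) = fold (row_act d k) w (\<lambda>_. 0) (Suc d)"
proof -
  have "encodes_row d r c \<Longrightarrow> encodes_row d (fold (insert_ge k) w r) (fold (row_act d k) w c)" for r c
    using assms by (induction w arbitrary: r c) (simp_all add: encodes_row_insert_ge)
  then have "encodes_row d (fold (insert_ge k) w []) (fold (row_act d k) w (\<lambda>_. 0))"
    by (blast intro: encodes_row_empty)
  then show ?thesis by (simp add: encodes_row_def)
qed

lemma bounded_on_configs_out:
  assumes "o' \<notin> S" "\<And>c. 0 \<le> F c \<and> F c \<le> B + real (c o')"
  shows "bounded_on_configs S F"
  unfolding bounded_on_configs_def using assms
  by (auto intro!: exI[of _ B]) (metis add.right_neutral of_nat_0)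

section \<open>Mean growth of the row in equilibrium\<close>

definition row_output :: "nat \<Rightarrow> (nat \<Rightarrow> real) \<Rightarrow> nat \<Rightarrow> nat \<Rightarrow> (nat \<Rightarrow> nat) \<Rightarrow> real" where
  "row_output d \<alpha> k n c = word_mean d \<alpha> n (\<lambda>w. real (fold (row_act d k) w c (Suc d)))"

lemma row_output_Suc:
  "row_output d \<alpha> k (Suc n) c = (\<Sum>i=1..d. \<alpha> i * row_output d \<alpha> k n (row_act d k i c))"
  by (simp add: row_output_def word_mean_Suc)

lemma row_output_bounds:
  assumes "prob_dist d \<alpha>"
  shows "0 \<le> row_output d \<alpha> k n c \<and> row_output d \<alpha> k n c \<le> real n + real (c (Suc d))"
proof
  have "word_mean d \<alpha> n (\<lambda>_. 0) \<le> row_output d \<alpha> k n c"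
    unfolding row_output_def by (intro word_mean_mono assms) simp
  then show "0 \<le> row_output d \<alpha> k n c" by (simp add: word_mean_const[OF assms])
  have "row_output d \<alpha> k n c \<le> word_mean d \<alpha> n (\<lambda>_. real n + real (c (Suc d)))"
    unfolding row_output_def using fold_row_act_output_le[of _ d k c]
    by (intro word_mean_mono assms) (metis of_nat_add of_nat_mono)
  then show "row_output d \<alpha> k n c \<le> real n + real (c (Suc d))"
    by (simp add: word_mean_const[OF assms])
qed

lemma row_output_removed:
  assumes "prob_dist d \<alpha>" "removed d c c'"
  shows "row_output d \<alpha> k n c \<le> row_output d \<alpha> k n c'"
    and "row_output d \<alpha> k n c' \<le> row_output d \<alpha> k n c + 1"
proof -
  have *: "fold (row_act d k) w c (Suc d) \<le> fold (row_act d k) w c' (Suc d)"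
     "fold (row_act d k) w c' (Suc d) \<le> Suc (fold (row_act d k) w c (Suc d))" if "set w \<subseteq> {1..d}" for w
    using removed_output[OF removed_fold_row_act[OF assms(2) that]] by auto
  show "row_output d \<alpha> k n c \<le> row_output d \<alpha> k n c'"
    unfolding row_output_def using * by (intro word_mean_mono assms) simp
  have "row_output d \<alpha> k n c'
      \<le> word_mean d \<alpha> n (\<lambda>w. real (fold (row_act d k) w c (Suc d)) + 1)"
    unfolding row_output_def
    by (intro word_mean_mono assms) (use * in \<open>metis of_nat_Suc of_nat_mono add.commute\<close>)
  then show "row_output d \<alpha> k n c' \<le> row_output d \<alpha> k n c + 1"
    by (simp add: row_output_def word_mean_add word_mean_const[OF assms(1)])
qed

text \<open>Burke's theorem for one site: letters of type \<open>i\<close> are arrivals, bumping attempts are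
  services, and the unused services together with the arrivals form the services of the next site.\<close>

lemma config_mean_row_site:
  assumes F: "\<And>c. 0 \<le> F c \<and> F c \<le> B + real (c (Suc d))"
    and S: "finite S" "S \<subseteq> {..d}" "i \<in> S" and \<rho>: "0 \<le> \<rho> i" "\<rho> i < 1"
  shows "config_mean S \<rho> (\<lambda>c. F (expel d i c)) + \<rho> i * config_mean S \<rho> (\<lambda>c. F (expel d (Suc i) (add_at i c)))
    = \<rho> i * config_mean S \<rho> F + config_mean S \<rho> (\<lambda>c. F (expel d (Suc i) c))"
proof -
  have id: "i \<le> d" using S by auto
  have bd: "bounded_on_configs S (\<lambda>c. F (expel d j c))" for j
  proof (rule bounded_on_configs_out[where o' = "Suc d" and B = "B + 1"])
    fix c show "0 \<le> F (expel d j c) \<and> F (expel d j c) \<le> B + 1 + real (c (Suc d))"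
      using F[of "expel d j c"] removed_output[OF removed_expel[of d c j]] by auto
  qed (use S in auto)
  \<comment> \<open>If site \<open>i\<close> is empty, the attempt passes to the next site.
    Otherwise it removes the particle just added by the resampling and restores the
    configuration.\<close>
  have "config_mean S \<rho> (\<lambda>c. F (expel d i c))
     = (1 - \<rho> i) * config_mean S \<rho> (\<lambda>c. F (expel d (Suc i) (c(i := 0)))) + \<rho> i * config_mean S \<rho> F"
    using config_mean_resample[of S i \<rho>, OF S(1,3) \<rho> bd[of i]] id by (simp add: expel_unfold)
  moreover have "config_mean S \<rho> (\<lambda>c. F (expel d (Suc i) c))
     = (1 - \<rho> i) * config_mean S \<rho> (\<lambda>c. F (expel d (Suc i) (c(i := 0))))
       + \<rho> i * config_mean S \<rho> (\<lambda>c. F (expel d (Suc i) (add_at i c)))"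
    using config_mean_resample[of S i \<rho>, OF S(1,3) \<rho> bd[of "Suc i"]] .
  ultimately show ?thesis by simp
qed

lemma row_output_upper:
  assumes \<alpha>: "prob_dist d \<alpha>" and k: "1 \<le> k" "k \<le> d"
    and \<beta>: "0 < \<beta>" "\<And>i. i \<in> {k..d} \<Longrightarrow> \<alpha> i < \<beta>"
  shows "row_output d \<alpha> k n (\<lambda>_. 0) \<le> real n * \<beta> + (\<Sum>i=k..d. \<alpha> i / (\<beta> - \<alpha> i))"
proof -
  define S where "S = {k..d}"
  define \<rho> where "\<rho> i = \<alpha> i / \<beta>" for i
  let ?E = "config_mean S \<rho>"
  let ?f = "row_output d \<alpha> k"
  have S: "finite S" "S \<subseteq> {..d}" "Suc d \<notin> S" by (auto simp: S_def)
  have \<rho>: "0 \<le> \<rho> i \<and> \<rho> i < 1" if "i \<in> S" for i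
    using that \<alpha> \<beta> k by (auto simp: \<rho>_def S_def prob_dist_def)
  have bd: "bounded_on_configs S (?f n)" for n
    using row_output_bounds[OF \<alpha>] S(3) by (intro bounded_on_configs_out[where o' = "Suc d"]) auto
  have bd_expel: "bounded_on_configs S (\<lambda>c. ?f n (expel d j c))" for j n
  proof (rule bounded_on_configs_out[where o' = "Suc d" and B = "real n + 1"])
    fix c show "0 \<le> ?f n (expel d j c) \<and> ?f n (expel d j c) \<le> real n + 1 + real (c (Suc d))"
      using row_output_bounds[OF \<alpha>, of k n "expel d j c"] removed_output[OF removed_expel[of d c j]] by auto
  qed (use S in auto)
  note int = bounded_on_configs_integrable[OF _ S(1), of _ \<rho>]
  have step: "?E (?f (Suc n)) \<le> ?E (?f n) + \<beta>" for n
  proof -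
    \<comment> \<open>\<open>?g j\<close> is the mean after one attempt entering at site
      \<open>j\<close>. Scaled by \<beta>, the one-site identity turns letter \<open>i\<close> into
      a difference of these, so the sum over the letters telescopes.\<close>
    let ?g = "\<lambda>j. ?E (\<lambda>c. ?f n (expel d j c))"
    have site: "\<alpha> i * ?E (\<lambda>c. ?f n (row_act d k i c)) = \<alpha> i * ?E (?f n) + \<beta> * (?g (Suc i) - ?g i)"
      if "i \<in> S" for i
    proof -
      have "?g i + \<rho> i * ?E (\<lambda>c. ?f n (expel d (Suc i) (add_at i c))) = \<rho> i * ?E (?f n) + ?g (Suc i)"
        using \<rho>[OF that]
        by (intro config_mean_row_site[where F = "?f n" and B = "real n" and d = d, OF row_output_bounds[OF \<alpha>] S(1,2) that])
           simp_all
      from arg_cong[OF this, of "(*) \<beta>"]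
      have "\<beta> * ?g i + \<beta> * \<rho> i * ?E (\<lambda>c. ?f n (expel d (Suc i) (add_at i c)))
          = \<beta> * \<rho> i * ?E (?f n) + \<beta> * ?g (Suc i)"
        by (simp only: distrib_left mult.assoc)
      moreover have "\<beta> * \<rho> i = \<alpha> i" "k \<le> i" using \<beta>(1) that by (auto simp: \<rho>_def S_def)
      ultimately show ?thesis by (simp add: row_act_def right_diff_distrib)
    qed
    have bd_act: "bounded_on_configs S (\<lambda>c. ?f n (row_act d k i c))" if "i \<in> {1..d}" for i
    proof (cases "k \<le> i")
      case True
      then have "i \<in> S" using that by (simp add: S_def)
      then show ?thesis
        using bounded_on_configs_upd[OF bd_expel[of n "Suc i"]] True by (simp add: row_act_def)
    qed (simp add: row_act_def bd)
    have "?E (?f (Suc n)) = (\<Sum>i=1..d. \<alpha> i * ?E (\<lambda>c. ?f n (row_act d k i c)))"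
      unfolding row_output_Suc using int[OF bd_act] by simp
    also have "\<dots> = (\<Sum>i=1..d. \<alpha> i * ?E (?f n) + (if i \<in> S then \<beta> * (?g (Suc i) - ?g i) else 0))"
    proof (rule sum.cong[OF refl])
      fix i assume i: "i \<in> {1..d}"
      show "\<alpha> i * ?E (\<lambda>c. ?f n (row_act d k i c))
          = \<alpha> i * ?E (?f n) + (if i \<in> S then \<beta> * (?g (Suc i) - ?g i) else 0)"
      proof (cases "i \<in> S")
        case True
        then show ?thesis by (simp add: site)
      next
        case False
        then have "\<not> k \<le> i" using i by (simp add: S_def)
        then show ?thesis using False by (simp add: row_act_def)
      qed
    qed
    also have "\<dots> = (\<Sum>i=1..d. \<alpha> i) * ?E (?f n) + (\<Sum>i\<in>S. \<beta> * (?g (Suc i) - ?g i))"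
    proof -
      have "{1..d} \<inter> S = S" using k by (auto simp: S_def)
      then show ?thesis by (simp add: sum.distrib sum_distrib_right sum.inter_restrict[symmetric])
    qed
    also have "\<dots> = ?E (?f n) + \<beta> * (?g (Suc d) - ?g k)"
      using \<alpha> k sum_Suc_diff[of k d ?g] by (simp add: prob_dist_def S_def sum_distrib_left[symmetric])
    \<comment> \<open>An attempt entering beyond the last site adds at most 1. The extra letter
      itself, entering at \<open>k\<close>, never lowers the mean, so leaving it out keeps the
      bound.\<close>
    also have "?g (Suc d) - ?g k \<le> 1"
    proof -
      have "?g (Suc d) \<le> ?E (\<lambda>c. ?f n c + 1)"
        using int[OF bd]
        by (intro integral_mono int[OF bd_expel] row_output_removed(2)[OF \<alpha> removed_expel]) simp
      also have "\<dots> = ?E (?f n) + 1" using int[OF bd] by simp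
      also have "?E (?f n) \<le> ?g k"
        by (intro integral_mono int[OF bd_expel] int[OF bd] row_output_removed(1)[OF \<alpha> removed_expel])
      finally show ?thesis by simp
    qed
    finally show ?thesis using \<beta>(1) by simp
  qed
  have E: "?E (?f n) \<le> real n * \<beta>" for n
  proof (induction n)
    case 0
    \<comment> \<open>Without letters only the output counter is read, which lies outside
      \<open>S\<close> and is 0 under the product law.\<close>
    have "?E (?f 0) = ?E (\<lambda>_. 0)"
      using geometric_config_support[OF S(1) _ S(3)]
      by (intro integral_cong_AE) (auto simp: row_output_def AE_measure_pmf_iff)
    then show ?case by simp
  next
    case (Suc n)
    then show ?case using step[of n] by (simp add: algebra_simps)
  qed
  have "\<bar>?E (?f n) - ?f n (\<lambda>_. 0)\<bar> \<le> (\<Sum>i\<in>S. \<rho> i / (1 - \<rho> i))"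
  proof (rule config_mean_near_empty[OF S(1) \<rho> bd])
    fix c i assume "i \<in> S"
    then have "removed d (add_at i c) c" by (auto simp: removed_def S_def)
    then show "\<bar>?f n (add_at i c) - ?f n c\<bar> \<le> 1"
      using row_output_removed[OF \<alpha>, of "add_at i c" c k n] by linarith
  qed
  also have "(\<Sum>i\<in>S. \<rho> i / (1 - \<rho> i)) = (\<Sum>i=k..d. \<alpha> i / (\<beta> - \<alpha> i))"
    unfolding S_def \<rho>_def using \<beta>(1) by (intro sum.cong) (auto simp: field_simps)
  finally show ?thesis using E[of n] by linarith
qed

section \<open>The tandem queue\<close>

definition tandem_output :: "nat \<Rightarrow> (nat \<Rightarrow> real) \<Rightarrow> nat \<Rightarrow> nat \<Rightarrow> (nat \<Rightarrow> nat) \<Rightarrow> real" where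
  "tandem_output d \<alpha> k n c = word_mean d \<alpha> n (\<lambda>w. real (fold (serve k) w c 0))"

lemma tandem_output_Suc:
  "tandem_output d \<alpha> k (Suc n) c = (\<Sum>i=1..d. \<alpha> i * tandem_output d \<alpha> k n (serve k i c))"
  by (simp add: tandem_output_def word_mean_Suc)

lemma tandem_output_bounds:
  assumes "prob_dist d \<alpha>"
  shows "0 \<le> tandem_output d \<alpha> k n c \<and> tandem_output d \<alpha> k n c \<le> real n + real (c 0)"
proof
  have "word_mean d \<alpha> n (\<lambda>_. 0) \<le> tandem_output d \<alpha> k n c"
    unfolding tandem_output_def by (intro word_mean_mono assms) simp
  then show "0 \<le> tandem_output d \<alpha> k n c" by (simp add: word_mean_const[OF assms])
  have "tandem_output d \<alpha> k n c \<le> word_mean d \<alpha> n (\<lambda>_. real n + real (c 0))"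
    unfolding tandem_output_def using fold_serve_le[of k _ c 0]
    by (intro word_mean_mono assms) (metis add.commute of_nat_add of_nat_mono)
  then show "tandem_output d \<alpha> k n c \<le> real n + real (c 0)"
    by (simp add: word_mean_const[OF assms])
qed

section \<open>Monotonicity and equilibrium of the queues\<close>

text \<open>The additional customer can be taken as last in its queue: it moves on only when the
  service would have been idle without it.\<close>

lemma serve_add_at:
  assumes "j < k"
  shows "\<exists>l<k. serve k i (add_at j c) = serve k i c \<or> serve k i (add_at j c) = add_at l (serve k i c)"
proof (cases "busy k i (add_at j c) \<and> \<not> busy k i c")
  case True
  then have "i = j" "c j = 0" "1 \<le> j" by (auto simp: busy_def split: if_splits)
  then have "serve k i (add_at j c) = add_at (j - 1) (serve k i c)"
    using True by (auto simp: serve_def fun_eq_iff)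
  then show ?thesis using assms by (intro exI[of _ "j - 1"]) auto
next
  case False
  then have "busy k i (add_at j c) = busy k i c" by (auto simp: busy_def)
  then have "serve k i (add_at j c) = add_at j (serve k i c)"
    using assms by (auto simp: serve_def fun_eq_iff busy_def)
  then show ?thesis using assms by blast
qed

lemma fold_serve_add_at:
  assumes "j < k"
  shows "\<exists>l<k. fold (serve k) w (add_at j c) = fold (serve k) w c \<or>
     fold (serve k) w (add_at j c) = add_at l (fold (serve k) w c)"
  using assms
proof (induction w arbitrary: c j)
  case (Cons i w)
  obtain l where l: "l < k"
    and "serve k i (add_at j c) = serve k i c \<or> serve k i (add_at j c) = add_at l (serve k i c)"
    using serve_add_at[OF Cons.prems] by blast
  then consider "serve k i (add_at j c) = serve k i c" | "serve k i (add_at j c) = add_at l (serve k i c)"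
    by blast
  then show ?case
  proof cases
    case 1
    then show ?thesis using l by (auto simp only: fold_simps)
  next
    case 2
    then show ?thesis using Cons.IH[OF l, of "serve k i c"] by (simp only: fold_simps)
  qed
qed auto

lemma fold_serve_add_at_0: "0 < k \<Longrightarrow> fold (serve k) w (add_at 0 c) = add_at 0 (fold (serve k) w c)"
proof (induction w arbitrary: c)
  case (Cons i w)
  have "serve k i (add_at 0 c) = add_at 0 (serve k i c)"
    using Cons.prems by (auto simp: serve_def busy_def fun_eq_iff)
  then show ?case using Cons.IH[OF Cons.prems, of "serve k i c"] by (simp only: fold_simps)
qed (simp only: fold_simps)

lemma tandem_output_add_at:
  assumes "prob_dist d \<alpha>" "j < k"
  shows "tandem_output d \<alpha> k n c \<le> tandem_output d \<alpha> k n (add_at j c)"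
    and "tandem_output d \<alpha> k n (add_at j c) \<le> tandem_output d \<alpha> k n c + 1"
proof -
  have *: "fold (serve k) w c 0 \<le> fold (serve k) w (add_at j c) 0"
     "fold (serve k) w (add_at j c) 0 \<le> Suc (fold (serve k) w c 0)" for w
    using fold_serve_add_at[OF assms(2), of w c] by auto
  show "tandem_output d \<alpha> k n c \<le> tandem_output d \<alpha> k n (add_at j c)"
    unfolding tandem_output_def using * by (intro word_mean_mono assms) simp
  have "tandem_output d \<alpha> k n (add_at j c)
      \<le> word_mean d \<alpha> n (\<lambda>w. real (fold (serve k) w c 0) + 1)"
    unfolding tandem_output_def
    by (intro word_mean_mono assms) (use * in \<open>metis of_nat_Suc of_nat_mono add.commute\<close>)
  then show "tandem_output d \<alpha> k n (add_at j c) \<le> tandem_output d \<alpha> k n c + 1"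
    by (simp add: tandem_output_def word_mean_add word_mean_const[OF assms(1)])
qed

lemma tandem_output_add_at_0:
  assumes "prob_dist d \<alpha>" "0 < k"
  shows "tandem_output d \<alpha> k n (add_at 0 c) = tandem_output d \<alpha> k n c + 1"
proof -
  have "tandem_output d \<alpha> k n (add_at 0 c) = word_mean d \<alpha> n (\<lambda>w. real (fold (serve k) w c 0) + 1)"
    by (simp add: tandem_output_def fold_serve_add_at_0[OF assms(2)] add.commute)
  then show ?thesis by (simp add: tandem_output_def word_mean_add word_mean_const[OF assms(1)])
qed

text \<open>Resample queue \<open>j\<close>: if it is empty the service is idle, otherwise the added
  customer moves to \<open>j - 1\<close>. Comparison with the resampling of \<open>F\<close> itself
  eliminates the empty case.\<close>

lemma config_mean_tandem_site:
  assumes F: "\<And>c. 0 \<le> F c \<and> F c \<le> B + real (c 0)"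
    and S: "finite S" "0 \<notin> S" "j \<in> S" "j < k" and \<rho>: "0 \<le> \<rho> j" "\<rho> j < 1"
  shows "config_mean S \<rho> (\<lambda>c. F (serve k j c)) + \<rho> j * config_mean S \<rho> (\<lambda>c. F (add_at j c))
    = config_mean S \<rho> F + \<rho> j * config_mean S \<rho> (\<lambda>c. F (add_at (j - 1) c))"
proof -
  have j: "j \<noteq> 0" using S by metis
  have bd: "bounded_on_configs S F"
    using F S(2) by (rule bounded_on_configs_out[rotated])
  have bd': "bounded_on_configs S (\<lambda>c. F (serve k j c))"
  proof (rule bounded_on_configs_out[where o' = 0 and B = "B + 1"])
    fix c show "0 \<le> F (serve k j c) \<and> F (serve k j c) \<le> B + 1 + real (c 0)"
      using F[of "serve k j c"] serve_le[of k j c 0] by auto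
  qed (use S in auto)
  have 1: "serve k j (c(j := 0)) = c(j := 0)" for c
    using S(4) by (intro serve_idle) auto
  have 2: "serve k j (add_at j c) = add_at (j - 1) c" for c
    using S(4) j by (auto simp: serve_def busy_def fun_eq_iff)
  have "config_mean S \<rho> (\<lambda>c. F (serve k j c))
     = (1 - \<rho> j) * config_mean S \<rho> (\<lambda>c. F (c(j := 0)))
       + \<rho> j * config_mean S \<rho> (\<lambda>c. F (add_at (j - 1) c))"
    using config_mean_resample[of S j \<rho>, OF S(1,3) \<rho> bd'] unfolding 1 2 .
  then show ?thesis
    using config_mean_resample[of S j \<rho>, OF S(1,3) \<rho> bd] by simp
qed

text \<open>Arrivals thinned to rate \<theta> put queue \<open>j\<close> in equilibrium with load
  \<open>\<theta> / \<alpha> j\<close>, and departures again have rate \<theta>. The remaining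
  arrivals, of rate \<open>\<alpha> k - \<theta>\<close>, are additional customers and cannot reduce
  the output.\<close>

lemma tandem_output_lower:
  assumes \<alpha>: "prob_dist d \<alpha>" and k: "1 \<le> k" "k \<le> d"
    and \<theta>: "0 < \<theta>" "\<And>j. j \<in> {1..k} \<Longrightarrow> \<theta> < \<alpha> j"
  shows "real n * \<theta> - (\<Sum>j=1..<k. \<theta> / (\<alpha> j - \<theta>)) \<le> tandem_output d \<alpha> k n (\<lambda>_. 0)"
proof -
  define S where "S = {1..<k}"
  define \<rho> where "\<rho> j = \<theta> / \<alpha> j" for j
  let ?E = "config_mean S \<rho>"
  let ?f = "tandem_output d \<alpha> k"
  have S: "finite S" "0 \<notin> S" by (auto simp: S_def)
  have pos: "0 < \<alpha> j" if "j \<in> S" for j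
    using that \<theta>(1) \<theta>(2)[of j] by (auto simp: S_def)
  have \<rho>: "0 \<le> \<rho> j \<and> \<rho> j < 1" if "j \<in> S" for j
    using that \<theta>(1) \<theta>(2)[of j] by (auto simp: \<rho>_def S_def)
  have bd: "bounded_on_configs S (?f n)" for n
    using S(2) tandem_output_bounds[OF \<alpha>] by (rule bounded_on_configs_out)
  have bd_serve: "bounded_on_configs S (\<lambda>c. ?f n (serve k j c))" for j n
  proof (rule bounded_on_configs_out[where o' = 0 and B = "real n + 1"])
    fix c show "0 \<le> ?f n (serve k j c) \<and> ?f n (serve k j c) \<le> real n + 1 + real (c 0)"
      using tandem_output_bounds[OF \<alpha>, of k n "serve k j c"] serve_le[of k j c 0] by auto
  qed (use S in auto)
  have bd_add: "bounded_on_configs S (\<lambda>c. ?f n (add_at j c))" for j n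
  proof (rule bounded_on_configs_out[where o' = 0 and B = "real n + 1"])
    fix c show "0 \<le> ?f n (add_at j c) \<and> ?f n (add_at j c) \<le> real n + 1 + real (c 0)"
      using tandem_output_bounds[OF \<alpha>, of k n "add_at j c"] by (cases "j = 0") auto
  qed (use S in auto)
  note int = bounded_on_configs_integrable[OF _ S(1), of _ \<rho>]
  have step: "?E (?f n) + \<theta> \<le> ?E (?f (Suc n))" for n
  proof -
    let ?g = "\<lambda>j. ?E (\<lambda>c. ?f n (add_at j c))"
    let ?s = "\<lambda>j. \<alpha> j * ?E (\<lambda>c. ?f n (serve k j c))"
    have site: "?s j = \<alpha> j * ?E (?f n) + \<theta> * (?g (j - 1) - ?g j)" if "j \<in> S" for j
    proof -
      have "?E (\<lambda>c. ?f n (serve k j c)) + \<rho> j * ?g j = ?E (?f n) + \<rho> j * ?g (j - 1)"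
        using config_mean_tandem_site[where F = "?f n" and B = "real n", OF tandem_output_bounds[OF \<alpha>] S that]
          \<rho>[OF that] that by (simp add: S_def)
      from arg_cong[OF this, of "(*) (\<alpha> j)"]
      have "?s j + \<alpha> j * \<rho> j * ?g j = \<alpha> j * ?E (?f n) + \<alpha> j * \<rho> j * ?g (j - 1)"
        by (simp only: distrib_left mult.assoc)
      moreover have "\<alpha> j * \<rho> j = \<theta>" using pos[OF that] by (simp add: \<rho>_def)
      ultimately show ?thesis by (simp add: right_diff_distrib)
    qed
    have top: "?s k = \<alpha> k * ?g (k - 1)"
    proof -
      \<comment> \<open>On the support entry \<open>k\<close> is 0 and truncated subtraction keeps
        it there, so letter \<open>k\<close> merely adds a customer at \<open>k - 1\<close>, which
        is the output itself when k = 1.\<close>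
      have "serve k k c = add_at (k - 1) c" if "c k = 0" for c
        using that k by (auto simp: serve_def busy_def fun_eq_iff)
      moreover have "k \<notin> S" by (simp add: S_def)
      ultimately have "?E (\<lambda>c. ?f n (serve k k c)) = ?g (k - 1)"
        using geometric_config_support[OF S(1)] 
        by (intro integral_cong_AE) (auto simp: AE_measure_pmf_iff)
      then show ?thesis by simp
    qed
    have rest: "?s j = \<alpha> j * ?E (?f n)" if "k < j" for j
      using that by (simp add: serve_def busy_def)
    have telescope: "(\<Sum>j=1..<m. ?g (j - 1) - ?g j) = ?g 0 - ?g (m - 1)" if "1 \<le> m" for m
      using that by (induction m rule: dec_induct) simp_all
    have split: "(\<Sum>j=1..d. h j) = (\<Sum>j\<in>S. h j) + h k + (\<Sum>j\<in>{k<..d}. h j)" for h :: "nat \<Rightarrow> real"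
    proof -
      have "{1..d} = insert k S \<union> {k<..d}" using k by (auto simp: S_def)
      moreover have "k \<notin> S" "insert k S \<inter> {k<..d} = {}" by (auto simp: S_def)
      ultimately show ?thesis using S(1) by (simp add: sum.union_disjoint)
    qed
    have "(\<Sum>j\<in>S. ?s j) = (\<Sum>j\<in>S. \<alpha> j * ?E (?f n) + \<theta> * (?g (j - 1) - ?g j))"
      by (rule sum.cong[OF refl site])
    also have "\<dots> = (\<Sum>j\<in>S. \<alpha> j) * ?E (?f n) + \<theta> * (\<Sum>j=1..<k. ?g (j - 1) - ?g j)"
      by (simp only: sum.distrib sum_distrib_right sum_distrib_left S_def)
    finally have queues: "(\<Sum>j\<in>S. ?s j)
        = (\<Sum>j\<in>S. \<alpha> j) * ?E (?f n) + \<theta> * (?g 0 - ?g (k - 1))"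
      unfolding telescope[OF k(1)] .
    have idle: "(\<Sum>j\<in>{k<..d}. ?s j) = (\<Sum>j\<in>{k<..d}. \<alpha> j) * ?E (?f n)"
      unfolding sum_distrib_right by (rule sum.cong[OF refl rest]) simp
    have "?E (?f (Suc n)) = (\<Sum>j=1..d. ?s j)"
      unfolding tandem_output_Suc using int[OF bd_serve] by simp
    also have "\<dots> = (\<Sum>j\<in>S. \<alpha> j) * ?E (?f n) + \<theta> * (?g 0 - ?g (k - 1)) + \<alpha> k * ?g (k - 1)
        + (\<Sum>j\<in>{k<..d}. \<alpha> j) * ?E (?f n)"
      unfolding split top queues idle ..
    \<comment> \<open>Splitting the arrival rate into \<theta> and
      \<open>\<alpha> k - \<theta>\<close> cancels the lower end of the telescoped sum; what remains
      is the thinned system plus the excess arrivals.\<close>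
    also have "\<dots> = ((\<Sum>j\<in>S. \<alpha> j) + (\<Sum>j\<in>{k<..d}. \<alpha> j)) * ?E (?f n) + \<theta> * ?g 0
        + (\<alpha> k - \<theta>) * ?g (k - 1)"
      by (simp add: algebra_simps)
    also have "(\<Sum>j\<in>S. \<alpha> j) + (\<Sum>j\<in>{k<..d}. \<alpha> j) = 1 - \<alpha> k"
      using split[of \<alpha>] \<alpha> by (simp add: prob_dist_def)
    also have "?g 0 = ?E (?f n) + 1"
      using k int[OF bd] by (simp add: tandem_output_add_at_0[OF \<alpha>])
    finally have "?E (?f (Suc n)) = (1 - \<alpha> k) * ?E (?f n) + \<theta> * (?E (?f n) + 1) + (\<alpha> k - \<theta>) * ?g (k - 1)" .
    moreover have "(\<alpha> k - \<theta>) * ?E (?f n) \<le> (\<alpha> k - \<theta>) * ?g (k - 1)"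
    proof (rule mult_left_mono)
      show "?E (?f n) \<le> ?g (k - 1)"
        using k by (intro integral_mono int[OF bd] int[OF bd_add] tandem_output_add_at(1)[OF \<alpha>]) simp
    qed (use \<theta>(2)[of k] k in simp)
    ultimately show ?thesis by (simp add: algebra_simps)
  qed
  have E: "real n * \<theta> \<le> ?E (?f n)" for n
  proof (induction n)
    case 0
    have "0 \<le> ?E (?f 0)" using tandem_output_bounds[OF \<alpha>] by (intro integral_nonneg_AE) simp
    then show ?case by simp
  next
    case (Suc n)
    then show ?case using step[of n] by (simp add: algebra_simps)
  qed
  have "\<bar>?E (?f n) - ?f n (\<lambda>_. 0)\<bar> \<le> (\<Sum>j\<in>S. \<rho> j / (1 - \<rho> j))"
  proof (rule config_mean_near_empty[OF S(1) \<rho> bd])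
    fix c j assume "j \<in> S"
    then show "\<bar>?f n (add_at j c) - ?f n c\<bar> \<le> 1"
      using tandem_output_add_at[OF \<alpha>, of j k n c] by (simp add: S_def)
  qed
  also have "(\<Sum>j\<in>S. \<rho> j / (1 - \<rho> j)) = (\<Sum>j=1..<k. \<theta> / (\<alpha> j - \<theta>))"
  proof (rule sum.cong)
    fix j assume "j \<in> {1..<k}"
    then have "0 < \<alpha> j" "\<theta> < \<alpha> j" using pos \<theta>(2)[of j] by (auto simp: S_def)
    then show "\<rho> j / (1 - \<rho> j) = \<theta> / (\<alpha> j - \<theta>)" by (simp add: \<rho>_def field_simps)
  qed (simp add: S_def)
  finally show ?thesis using E[of n] by linarith
qed

section \<open>The expected row lengths\<close>

text \<open>The two terms balance at \<open>\<epsilon> = sqrt (b / a)\<close>. As \<open>a\<close>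
  or \<open>b\<close> may vanish, both are first shifted by \<delta> > 0, and then \<delta> tends to
  0.\<close>

lemma le_two_sqrt_of_forall_le:
  fixes a b x :: real
  assumes "0 \<le> a" "0 \<le> b" and le: "\<And>\<epsilon>. 0 < \<epsilon> \<Longrightarrow> x \<le> a * \<epsilon> + b / \<epsilon>"
  shows "x \<le> 2 * sqrt (a * b)"
proof (rule tendsto_lowerbound)
  show "((\<lambda>\<delta>. 2 * sqrt ((a + \<delta>) * (b + \<delta>))) \<longlongrightarrow> 2 * sqrt (a * b)) (at_right 0)"
    by (auto intro!: tendsto_eq_intros)
  show "\<forall>\<^sub>F \<delta> in at_right 0. x \<le> 2 * sqrt ((a + \<delta>) * (b + \<delta>))"
    using eventually_at_right_less[of "0::real"]
  proof eventually_elim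
    case (elim \<delta>)
    define s t where "s = sqrt (a + \<delta>)" and "t = sqrt (b + \<delta>)"
    have st: "0 < s" "0 < t" "s * s = a + \<delta>" "t * t = b + \<delta>"
      using elim assms by (simp_all add: s_def t_def)
    have "x \<le> a * (t / s) + b / (t / s)" using st by (intro le) simp
    also have "\<dots> \<le> (s * s) * (t / s) + (t * t) / (t / s)"
      using st elim by (intro add_mono mult_right_mono divide_right_mono) auto
    also have "\<dots> = 2 * (s * t)" using st(1,2) by simp
    also have "s * t = sqrt ((a + \<delta>) * (b + \<delta>))" by (simp add: s_def t_def real_sqrt_mult)
    finally show ?case .
  qed
qed simp

lemma SW_expect_part_eq:
  "SW_expect_part d \<alpha> n k = word_mean d \<alpha> n (\<lambda>w. real (shape_part (shRSK w) k))"
  by (simp add: SW_expect_part_def word_mean_def)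

lemma SW_expect_part_upper:
  assumes \<alpha>: "prob_dist d \<alpha>" and dec: "\<And>i j. 1 \<le> i \<Longrightarrow> i \<le> j \<Longrightarrow> j \<le> d \<Longrightarrow> \<alpha> j \<le> \<alpha> i"
    and k: "1 \<le> k" "k \<le> d"
  shows "SW_expect_part d \<alpha> n k \<le> \<alpha> k * n + 2 * sqrt ((\<Sum>i=k..d. \<alpha> i) * n)"
proof -
  have nonneg: "0 \<le> \<alpha> i" if "i \<in> {k..d}" for i using \<alpha> that k by (simp add: prob_dist_def)
  have "SW_expect_part d \<alpha> n k \<le> row_output d \<alpha> k n (\<lambda>_. 0)"
    unfolding SW_expect_part_eq row_output_def
  proof (rule word_mean_mono[OF \<alpha>])
    fix w assume w: "set w \<subseteq> {1..d}"
    then have "shape_part (shRSK w) (Suc (k - 1)) \<le> length (fold (insert_ge (1 + (k - 1))) w [])"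
      by (intro shape_part_le_restricted_row) auto
    then show "real (shape_part (shRSK w) k) \<le> real (fold (row_act d k) w (\<lambda>_. 0) (Suc d))"
      using k length_fold_insert_ge_eq[OF w, of k] by simp
  qed
  also have "row_output d \<alpha> k n (\<lambda>_. 0) - \<alpha> k * n \<le> 2 * sqrt (real n * (\<Sum>i=k..d. \<alpha> i))"
  proof (rule le_two_sqrt_of_forall_le)
    fix \<epsilon> :: real assume \<epsilon>: "0 < \<epsilon>"
    have le: "\<alpha> i \<le> \<alpha> k" if "i \<in> {k..d}" for i using dec k that by simp
    \<comment> \<open>The choice \<open>\<beta> = \<alpha> k + \<epsilon>\<close> makes every
      denominator at least \<epsilon>, since the probabilities are decreasing.\<close>
    have "row_output d \<alpha> k n (\<lambda>_. 0)
      \<le> real n * (\<alpha> k + \<epsilon>) + (\<Sum>i=k..d. \<alpha> i / ((\<alpha> k + \<epsilon>) - \<alpha> i))"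
      using \<epsilon> nonneg[of k] le k by (intro row_output_upper \<alpha>) force+
    also have "(\<Sum>i=k..d. \<alpha> i / ((\<alpha> k + \<epsilon>) - \<alpha> i)) \<le> (\<Sum>i=k..d. \<alpha> i / \<epsilon>)"
    proof (rule sum_mono)
      fix i assume i: "i \<in> {k..d}"
      show "\<alpha> i / ((\<alpha> k + \<epsilon>) - \<alpha> i) \<le> \<alpha> i / \<epsilon>"
        using \<epsilon> nonneg[OF i] le[OF i] by (intro divide_left_mono mult_pos_pos) auto
    qed
    finally show "row_output d \<alpha> k n (\<lambda>_. 0) - \<alpha> k * n \<le> real n * \<epsilon> + (\<Sum>i=k..d. \<alpha> i) / \<epsilon>"
      by (simp add: sum_divide_distrib algebra_simps)
  qed (use nonneg in \<open>auto intro: sum_nonneg\<close>)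
  finally show ?thesis by (simp add: mult.commute)
qed

lemma SW_expect_part_lower:
  assumes \<alpha>: "prob_dist d \<alpha>" and dec: "\<And>i j. 1 \<le> i \<Longrightarrow> i \<le> j \<Longrightarrow> j \<le> d \<Longrightarrow> \<alpha> j \<le> \<alpha> i"
    and k: "1 \<le> k" "k \<le> d"
  shows "\<alpha> k * n - 2 * sqrt (\<alpha> k * k * n) \<le> SW_expect_part d \<alpha> n k"
proof -
  have nonneg: "0 \<le> \<alpha> k" using \<alpha> k by (simp add: prob_dist_def)
  have "tandem_output d \<alpha> k n (\<lambda>_. 0) \<le> SW_expect_part d \<alpha> n k"
    unfolding SW_expect_part_eq tandem_output_def
  proof (rule word_mean_mono[OF \<alpha>])
    fix w assume "set w \<subseteq> {1..d}"
    then have "fold (serve (Suc (0 + (k - 1)))) w (\<lambda>_. 0) 0 \<le> shape_part (shRSK w) (Suc (k - 1))"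
      by (intro tandem_output_le_shape_part) auto
    then show "real (fold (serve k) w (\<lambda>_. 0) 0) \<le> real (shape_part (shRSK w) k)"
      using k by simp
  qed
  moreover have "\<alpha> k * n - tandem_output d \<alpha> k n (\<lambda>_. 0) \<le> 2 * sqrt (real n * (\<alpha> k * k))"
  proof (rule le_two_sqrt_of_forall_le)
    fix \<epsilon> :: real assume \<epsilon>: "0 < \<epsilon>"
    show "\<alpha> k * n - tandem_output d \<alpha> k n (\<lambda>_. 0) \<le> real n * \<epsilon> + \<alpha> k * k / \<epsilon>"
    proof (cases "\<epsilon> < \<alpha> k")
      case True
      have "real n * (\<alpha> k - \<epsilon>) - (\<Sum>j=1..<k. (\<alpha> k - \<epsilon>) / (\<alpha> j - (\<alpha> k - \<epsilon>)))
          \<le> tandem_output d \<alpha> k n (\<lambda>_. 0)"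
      proof (rule tandem_output_lower[OF \<alpha> k])
        fix j assume "j \<in> {1..k}"
        then show "\<alpha> k - \<epsilon> < \<alpha> j" using dec[of j k] k \<epsilon> by simp
      qed (use True in simp)
      moreover have "(\<Sum>j=1..<k. (\<alpha> k - \<epsilon>) / (\<alpha> j - (\<alpha> k - \<epsilon>))) \<le> (\<Sum>j=1..<k. \<alpha> k / \<epsilon>)"
      proof (rule sum_mono)
        fix j assume "j \<in> {1..<k}"
        then show "(\<alpha> k - \<epsilon>) / (\<alpha> j - (\<alpha> k - \<epsilon>)) \<le> \<alpha> k / \<epsilon>"
          using dec[of j k] k \<epsilon> True by (intro frac_le) auto
      qed
      moreover have "(\<Sum>j=1..<k. \<alpha> k / \<epsilon>) \<le> \<alpha> k * k / \<epsilon>"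
      proof -
        have "real (k - 1) * (\<alpha> k / \<epsilon>) \<le> real k * (\<alpha> k / \<epsilon>)"
          using nonneg \<epsilon> by (intro mult_right_mono) auto
        then show ?thesis by (simp add: mult.commute)
      qed
      ultimately show ?thesis by (simp add: algebra_simps)
    next
      case False
      \<comment> \<open>Here \<open>\<alpha> k - \<epsilon>\<close> is not positive and cannot serve
        as an arrival rate, but the claim follows from nonnegativity of the output.\<close>
      then have "\<alpha> k * n \<le> real n * \<epsilon>" by (simp add: mult.commute[of "\<alpha> k"] mult_left_mono)
      moreover have "0 \<le> \<alpha> k * k / \<epsilon>" using nonneg \<epsilon> by simp
      ultimately show ?thesis using tandem_output_bounds[OF \<alpha>, of k n "\<lambda>_. 0"] by linarith
    qed
  qed (use nonneg in auto)
  ultimately show ?thesis by (simp add: mult.commute mult.left_commute)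
qed

theorem mainTheorem1:
  fixes d n k :: nat and \<alpha> :: "nat \<Rightarrow> real"
  assumes "prob_dist d \<alpha>"
    and "\<And>i j. 1 \<le> i \<Longrightarrow> i \<le> j \<Longrightarrow> j \<le> d \<Longrightarrow> \<alpha> j \<le> \<alpha> i"
    and "1 \<le> k" and "k \<le> d"
  shows "\<alpha> k * n - 2 * sqrt (\<alpha> k * k * n) \<le> SW_expect_part d \<alpha> n k
       \<and> SW_expect_part d \<alpha> n k \<le> \<alpha> k * n + 2 * sqrt ((\<Sum>i=k..d. \<alpha> i) * n)
       \<and> \<alpha> k * n - 2 * sqrt (min 1 (\<alpha> k * d) * n) \<le> SW_expect_part d \<alpha> n k
       \<and> SW_expect_part d \<alpha> n k \<le> \<alpha> k * n + 2 * sqrt (min 1 (\<alpha> k * d) * n)"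
proof -
  have nonneg: "\<And>i. i \<in> {1..d} \<Longrightarrow> 0 \<le> \<alpha> i" and total: "(\<Sum>i=1..d. \<alpha> i) = 1"
    using assms(1) by (auto simp: prob_dist_def)
  have part: "(\<Sum>i\<in>A. \<alpha> i) \<le> 1" if "A \<subseteq> {1..d}" for A
    using sum_mono2[of "{1..d}" A \<alpha>] that nonneg total by auto
  \<comment> \<open>The first \<open>k\<close> probabilities are each at least
    \<open>\<alpha> k\<close> and sum to at most 1, which bounds the lower radicand.\<close>
  have "\<alpha> k * k = (\<Sum>i=1..k. \<alpha> k)" by simp
  also have "\<dots> \<le> (\<Sum>i=1..k. \<alpha> i)" using assms(2,4) by (intro sum_mono) auto
  also have "\<dots> \<le> 1" using assms(4) by (intro part) auto
  finally have "\<alpha> k * k \<le> min 1 (\<alpha> k * d)"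
    using nonneg[of k] assms(3,4) by (simp add: mult_left_mono)
  then have lower: "sqrt (\<alpha> k * k * n) \<le> sqrt (min 1 (\<alpha> k * d) * n)"
    by (intro real_sqrt_le_mono mult_right_mono) auto
  \<comment> \<open>The upper radicand has at most \<open>d\<close> terms, none above
    \<open>\<alpha> k\<close>.\<close>
  have "(\<Sum>i=k..d. \<alpha> i) \<le> (\<Sum>i=k..d. \<alpha> k)" using assms(2,3) by (intro sum_mono) auto
  also have "\<dots> = real (Suc d - k) * \<alpha> k" by simp
  also have "\<dots> \<le> real d * \<alpha> k" using nonneg[of k] assms(3,4) by (intro mult_right_mono) auto
  finally have "(\<Sum>i=k..d. \<alpha> i) \<le> min 1 (\<alpha> k * d)"
    using part[of "{k..d}"] assms(3) by (simp add: mult.commute)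
  then have upper: "sqrt ((\<Sum>i=k..d. \<alpha> i) * n) \<le> sqrt (min 1 (\<alpha> k * d) * n)"
    by (intro real_sqrt_le_mono mult_right_mono) auto
  show ?thesis
    using SW_expect_part_lower[OF assms, of n] SW_expect_part_upper[OF assms, of n] lower upper
    by linarith
qed

end
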